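(* Let $N\in\mathbb{N}$, let $h>0$, let $a,b,x_0\in\mathbb{R}$, let $a_{1d},\dots,a_{Nd}\in\mathbb{R}$ be not all zero, and let $\phi$ be a continuous function on $[-Nh,0]$ (with $\phi(0)$ not necessarily equal to $x_0$). Let $u$ be the input function. Let $$\Delta(s)=s-a-\sum_{j=1}^{N}a_{jd}e^{-jsh},\qquad \Phi_j(s)=\int_{-jh}^{0}\phi(\tau)e^{-s\tau}\,d\tau\quad(1\le j\le N),$$ let $S_k$, $k\in\mathbb{Z}$, be the roots of $\Delta(s)=0$, and put $$C_k=\frac{1}{1+\sum_{j=1}^{N}j\,a_{jd}\,h\,e^{-jS_kh}},\qquad C^I_k=\frac{\sum_{j=1}^{N}a_{jd}\,e^{-jS_kh}\,\Phi_j(S_k)}{1+\sum_{j=1}^{N}j\,a_{jd}\,h\,e^{-jS_kh}} .$$ Then the state transition function can be expressed as $$\Psi(t)=\sum_{k=-\infty}^{\infty}C_k\,e^{S_kt},$$ and, for $t\ge 0$, the time response (solution) of $$\dot{x}(t)=a\,x(t)+\sum_{j=1}^{N}a_{jd}\,x(t-jh)+b\,u(t),\qquad x(0)=x_0,\qquad x(\tau)=\phi(\tau)\ \text{ for } -Nh\le\tau<0,$$ is given by $$x(t)=\sum_{k=-\infty}^{\infty}C_k\,e^{S_kt}x_0+\sum_{k=-\infty}^{\infty}C^I_k\,e^{S_kt}+\int_0^t\ \sum_{k=-\infty}^{\infty}C_k\,e^{S_k(t-\tau)}\,b\,u(\tau)\,d\tau .$$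
   Context: State transition function (fundamental solution): a function $\Psi(t)$ satisfying $\frac{d}{dt}\Psi(t)=a\Psi(t)+\sum_{j=1}^{N}a_{jd}\Psi(t-jh)$ for $t>0$, $\Psi(0)=1$, and $\Psi(t)=0$ for $t<0$; its Laplace transform is $1/\Delta(s)$. Each root satisfies $S_n=\frac1h W_k\big(\sum_{j=1}^{N}a_{jd}\,h\,e^{-jah}e^{-(j-1)(S_n-a)h}\big)+a$, where $W_k$ is the branch of the Lambert W function (the multivalued inverse of $w\mapsto we^w$) to which $S_n$ belongs. The roots are numbered so that $S_0$ has the largest real part; if $S_0$ is real then $S_{-n}=\overline{S_n}$ for $n>0$, and otherwise $S_{-(n+1)}=\overline{S_n}$ for $n\ge0$. Functions whose Laplace transforms are taken (in particular $x$ and $u$) are of exponential order.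
   Formalization: The formulas are proved for t > 0, with right limits Ψ(0) and x(0) at t = 0 (at t = 0 the sums can give 1/2 instead of 1); roots are assumed simple and numbered with |Im S_k| eventually nondecreasing in |k|, and two-sided series are limits of symmetric partial sums. *)

theory Defs
  imports "HOL-Analysis.Analysis"
begin

text \<open>
  Throughout, \<open>N\<close> is the number of delays, \<open>h\<close> the base delay, and \<open>ad j\<close> (for
  \<open>1 \<le> j \<le> N\<close>) the coefficient of the term delayed by \<open>j h\<close>.
\<close>

definition char_fun :: "nat \<Rightarrow> real \<Rightarrow> real \<Rightarrow> (nat \<Rightarrow> real) \<Rightarrow> complex \<Rightarrow> complex" where
  "char_fun N h a ad s =
     s - of_real a - (\<Sum>j=1..N. of_real (ad j) * exp (- (of_nat j * s * of_real h)))"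

definition hist_transform :: "real \<Rightarrow> (real \<Rightarrow> real) \<Rightarrow> nat \<Rightarrow> complex \<Rightarrow> complex" where
  "hist_transform h \<phi> j s =
     integral {- (real j * h)..0} (\<lambda>\<tau>. of_real (\<phi> \<tau>) * exp (- (s * of_real \<tau>)))"

definition coeff_denom :: "nat \<Rightarrow> real \<Rightarrow> (nat \<Rightarrow> real) \<Rightarrow> complex \<Rightarrow> complex" where
  "coeff_denom N h ad s =
     1 + (\<Sum>j=1..N. of_nat j * of_real (ad j) * of_real h * exp (- (of_nat j * s * of_real h)))"

definition coeff_C :: "nat \<Rightarrow> real \<Rightarrow> (nat \<Rightarrow> real) \<Rightarrow> complex \<Rightarrow> complex" where
  "coeff_C N h ad s = 1 / coeff_denom N h ad s"

definition coeff_CI ::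
    "nat \<Rightarrow> real \<Rightarrow> (nat \<Rightarrow> real) \<Rightarrow> (real \<Rightarrow> real) \<Rightarrow> complex \<Rightarrow> complex" where
  "coeff_CI N h ad \<phi> s =
     (\<Sum>j=1..N. of_real (ad j) * exp (- (of_nat j * s * of_real h)) * hist_transform h \<phi> j s)
       / coeff_denom N h ad s"

text \<open>
  A two-sided series is the limit of its symmetric partial sums.  For small \<open>t > 0\<close> the
  series of the terms \<open>coeff_CI \<dots> * exp (S k * t)\<close> need not converge absolutely when the initial
  function is merely continuous, so unordered summation would be too strong.
\<close>

definition bilateral_summable :: "(int \<Rightarrow> complex) \<Rightarrow> bool" where
  "bilateral_summable f \<longleftrightarrow> convergent (\<lambda>n::nat. \<Sum>k=- int n..int n. f k)"

definition bilateral_sum :: "(int \<Rightarrow> complex) \<Rightarrow> complex" where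
  "bilateral_sum f = lim (\<lambda>n::nat. \<Sum>k=- int n..int n. f k)"

text \<open>
  \<open>S\<close> lists every characteristic root exactly once.  Because convergence may be conditional, the
  listing must, apart from finitely many indices, proceed by increasing \<open>\<bar>Im\<bar>\<close>, as a numbering by
  branches of the Lambert W function does for a single delay.  Which root is \<open>S 0\<close>, and which
  member of a conjugate pair gets the positive index, is left free.
\<close>

definition root_numbering ::
    "nat \<Rightarrow> real \<Rightarrow> real \<Rightarrow> (nat \<Rightarrow> real) \<Rightarrow> (int \<Rightarrow> complex) \<Rightarrow> bool" where
  "root_numbering N h a ad S \<longleftrightarrow>
     bij_betw S UNIV {s. char_fun N h a ad s = 0} \<and>
     (\<exists>M. \<forall>m n. M \<le> \<bar>m\<bar> \<and> \<bar>m\<bar> < \<bar>n\<bar> \<longrightarrow> \<bar>Im (S m)\<bar> \<le> \<bar>Im (S n)\<bar>)"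

text \<open>
  The function \<open>x\<close> may jump at \<open>0\<close> (and so may the state transition function), hence its
  derivative may jump at \<open>j h\<close>, \<open>1 \<le> j \<le> N\<close>, and at discontinuities of the forcing term \<open>f\<close>.
  The equation is therefore required for positive times outside some countable set, together with
  continuity on \<open>[0, \<infinity>)\<close>.
\<close>

definition satisfies_dde ::
    "nat \<Rightarrow> real \<Rightarrow> real \<Rightarrow> (nat \<Rightarrow> real) \<Rightarrow> (real \<Rightarrow> real) \<Rightarrow> (real \<Rightarrow> real) \<Rightarrow> bool" where
  "satisfies_dde N h a ad f x \<longleftrightarrow>
     continuous_on {0..} x \<and>
     (\<exists>D. countable D \<and>
        (\<forall>t. t > 0 \<and> t \<notin> D \<longrightarrow>
          (x has_real_derivative
             a * x t + (\<Sum>j=1..N. ad j * x (t - real j * h)) + f t) (at t)))"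

definition state_transition ::
    "nat \<Rightarrow> real \<Rightarrow> real \<Rightarrow> (nat \<Rightarrow> real) \<Rightarrow> (real \<Rightarrow> real) \<Rightarrow> bool" where
  "state_transition N h a ad \<Psi> \<longleftrightarrow>
     satisfies_dde N h a ad (\<lambda>_. 0) \<Psi> \<and> \<Psi> 0 = 1 \<and> (\<forall>t<0. \<Psi> t = 0)"

definition time_response ::
    "nat \<Rightarrow> real \<Rightarrow> real \<Rightarrow> (nat \<Rightarrow> real) \<Rightarrow> real \<Rightarrow> (real \<Rightarrow> real) \<Rightarrow> real \<Rightarrow> (real \<Rightarrow> real)
      \<Rightarrow> (real \<Rightarrow> real) \<Rightarrow> bool" where
  "time_response N h a ad b u x0 \<phi> x \<longleftrightarrow>
     satisfies_dde N h a ad (\<lambda>t. b * u t) x \<and> x 0 = x0 \<and>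
     (\<forall>\<tau>. - (real N * h) \<le> \<tau> \<and> \<tau> < 0 \<longrightarrow> x \<tau> = \<phi> \<tau>)"

definition exponential_order :: "(real \<Rightarrow> real) \<Rightarrow> bool" where
  "exponential_order f \<longleftrightarrow> (\<exists>M c. \<forall>t\<ge>0. \<bar>f t\<bar> \<le> M * exp (c * t))"

definition transition_series ::
    "nat \<Rightarrow> real \<Rightarrow> (nat \<Rightarrow> real) \<Rightarrow> (int \<Rightarrow> complex) \<Rightarrow> real \<Rightarrow> complex" where
  "transition_series N h ad S t =
     bilateral_sum (\<lambda>k. coeff_C N h ad (S k) * exp (S k * of_real t))"

definition response_series ::
    "nat \<Rightarrow> real \<Rightarrow> (nat \<Rightarrow> real) \<Rightarrow> real \<Rightarrow> (real \<Rightarrow> real) \<Rightarrow> real \<Rightarrow> (real \<Rightarrow> real)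
      \<Rightarrow> (int \<Rightarrow> complex) \<Rightarrow> real \<Rightarrow> complex" where
  "response_series N h ad b u x0 \<phi> S t =
     bilateral_sum (\<lambda>k. coeff_C N h ad (S k) * exp (S k * of_real t) * of_real x0)
     + bilateral_sum (\<lambda>k. coeff_CI N h ad \<phi> (S k) * exp (S k * of_real t))
     + integral {0..t}
         (\<lambda>\<tau>. transition_series N h ad S (t - \<tau>) * of_real b * of_real (u \<tau>))"

end

theory Submission
  imports Defs "HOL-Complex_Analysis.Complex_Analysis"
begin

text \<open>
  Write \<open>\<Delta>\<close> for the characteristic function and \<open>\<Psi>\<^sub>n t\<close> for the sum of
  \<open>coeff_C * exp (S k * t)\<close> over \<open>\<bar>k\<bar> \<le> n\<close>. These terms are the residues of
  \<open>exp (s * t) / \<Delta> s\<close>, and every \<open>\<Psi>\<^sub>n\<close> is a smooth solution, on the whole real line, of the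
  homogeneous equation. A solution is determined by its history, so everything hinges on the
  behaviour of \<open>\<Psi>\<^sub>n\<close> on one delay window. Let \<open>m\<close> be the largest index with \<open>ad m \<noteq> 0\<close>. The
  claim is that \<open>\<Psi>\<^sub>n\<close> stays bounded on \<open>[\<epsilon> - m h, h]\<close>, tends to \<open>0\<close> on \<open>(- m h, 0)\<close> and to
  \<open>exp (a t)\<close> on \<open>(0, h]\<close>, exactly as \<open>\<Psi>\<close> does (\<open>partial_sum_bounded_first_delay\<close>,
  \<open>partial_sum_tendsto_first_delay\<close>).

  For the claim, residues are summed over the squares with corners \<open>\<plusminus>R \<plusminus> \<i>R\<close>, where \<open>R\<close> is
  chosen such that \<open>ad m * sin (m h R) = \<bar>ad m\<bar>\<close>. On the horizontal sides the imaginary parts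
  of \<open>s\<close> and of the leading exponential term of \<open>\<Delta>\<close> then have the same sign and cannot cancel,
  so that \<open>\<bar>\<Delta> s\<bar>\<close> is at least half of \<open>R + \<bar>ad m\<bar> exp (- m h Re s)\<close> (\<open>char_fun_on_level\<close>). For
  \<open>t \<le> 0\<close> this suffices to estimate the contour integral. For \<open>0 < t \<le> h\<close> the function
  \<open>1 / (s - a)\<close> is subtracted, which accounts for the residue \<open>exp (a t)\<close> and leaves a
  remainder of size \<open>exp (- h Re s) / \<bar>s\<bar>\<^sup>2\<close> on the right (\<open>square_sum_error\<close>).

  A symmetric partial sum need not be a sum over a square. Since the roots are numbered, up to
  finitely many, by increasing \<open>\<bar>Im\<bar>\<close>, the two differ by roots in two bands of height
  \<open>2 pi / (m h)\<close>, one above the square and one below it. There are at most eight of them,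
  because \<open>\<Delta>\<close> is injective on thin horizontal strips far to the left, and each contributes a
  term that tends to \<open>0\<close> uniformly for \<open>t \<ge> \<epsilon> - m h\<close> (\<open>partial_sum_near_square_sum\<close>).

  Variation of constants, restarted at time \<open>h / 2\<close>, expresses \<open>\<Psi>\<^sub>n\<close> and \<open>\<Psi>\<close> at later times by
  the same integrals over the window, and bounded convergence gives \<open>\<Psi>\<^sub>n t \<longlonglongrightarrow> \<Psi> t\<close> for all
  \<open>t > 0\<close> (\<open>partial_sum_tendsto\<close>). The series with \<open>coeff_CI\<close> has the partial sums
  \<open>\<Sum>j. ad j * \<integral> \<phi> \<tau> * \<Psi>\<^sub>n (t - j h - \<tau>) d\<tau>\<close>, and the arguments of \<open>\<Psi>\<^sub>n\<close> stay above \<open>- m h\<close>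
  where \<open>ad j \<noteq> 0\<close>; so bounded convergence applies again, although the series itself need not
  converge absolutely (\<open>history_partial_sum_tendsto\<close>). The limits are the terms of the
  variation of constants formula for \<open>x\<close> (\<open>time_response_formula\<close>).
\<close>

section \<open>A fundamental theorem of calculus with countably many exceptions\<close>

text \<open>
  Near an exceptional point only continuity of \<open>f\<close> is available. Number these points and let
  the oscillation of \<open>f\<close> near the \<open>n\<close>-th one be at most \<open>c / 2 ^ n\<close>. A tagged division may use
  a tag for two intervals, so these errors cannot simply be added; they are charged to the
  increments of a bounded increasing function \<open>J\<close> that rises by at least \<open>1 / 2 ^ n\<close> over
  every nondegenerate interval containing the \<open>n\<close>-th point, and these increments telescope.
\<close>

lemma fundamental_theorem_of_calculus_countable:
  fixes f :: "real \<Rightarrow> 'a::banach"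
  assumes "countable D" "a \<le> b"
    and cont: "continuous_on {a..b} f"
    and deriv: "\<And>x. x \<in> {a<..<b} - D \<Longrightarrow> (f has_vector_derivative f' x) (at x)"
  shows "(f' has_integral (f b - f a)) {a..b}"
proof -
  define E where "E = insert a (insert b D)"
  have E: "countable E" "E \<noteq> {}" using assms by (auto simp: E_def)
  define q where "q = from_nat_into E"
  define F where "F = (\<lambda>x. if x \<in> E then 0 else f' x)"
  define W where "W P = (\<Sum>n. if P n then (1/2::real)^n else 0)" for P
  have half: "summable (\<lambda>n. (1/2::real)^n)" by (simp add: summable_geometric)
  have sm: "summable (\<lambda>n. if P n then (1/2::real)^n else 0)" for P
    by (rule summable_comparison_test_ev[OF _ half]) auto
  have W0: "0 \<le> W P" for P
    unfolding W_def by (intro suminf_nonneg sm) auto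
  have W2: "W P \<le> 2" for P
    using suminf_le[OF _ sm half, of P] suminf_geometric[of "1/2::real"] by (simp add: W_def)
  have Wmono: "W P \<le> W Q" if "\<And>n. P n \<Longrightarrow> Q n" for P Q
    unfolding W_def by (intro suminf_le sm) (use that in auto)
  have Wjump: "W P + (1/2)^n \<le> W Q" if "\<And>n. P n \<Longrightarrow> Q n" "Q n" "\<not> P n" for P Q n
  proof -
    have single: "(\<lambda>k. if k = n then (1/2::real)^k else 0) sums (1/2)^n"
      by (rule sums_single)
    have "W P + (1/2)^n = (\<Sum>k. (if P k then (1/2::real)^k else 0) + (if k = n then (1/2)^k else 0))"
      unfolding W_def
      using suminf_add[OF sm sums_summable[OF single], of P] sums_unique[OF single] by simp
    also have "\<dots> \<le> W Q"
      unfolding W_def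
      by (intro suminf_le sm summable_add sums_summable[OF single]) (use that in auto)
    finally show ?thesis .
  qed
  \<comment> \<open>The first summand jumps to the right of an exceptional point and the second one at the point, so that
    the jump is seen from an interval that has the point as its left or as its right end.\<close>
  define J where "J y = W (\<lambda>n. q n < y) + W (\<lambda>n. q n \<le> y)" for y
  have J0: "0 \<le> J y" and J4: "J y \<le> 4" for y
    using W0 W2[of "\<lambda>n. q n < y"] W2[of "\<lambda>n. q n \<le> y"] by (auto simp: J_def)
  have Jmono: "J u \<le> J v" if "u \<le> v" for u v
    unfolding J_def by (intro add_mono Wmono) (use that in auto)
  have Jjump: "J u + (1/2)^n \<le> J v" if "u \<le> q n" "q n \<le> v" "u < v" for u v n
  proof (cases "u < q n")
    case True
    then show ?thesis
      using Wjump[of "\<lambda>k. q k \<le> u" "\<lambda>k. q k \<le> v" n] Wmono[of "\<lambda>k. q k < u" "\<lambda>k. q k < v"] that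
      by (force simp: J_def)
  next
    case False
    then show ?thesis
      using Wjump[of "\<lambda>k. q k < u" "\<lambda>k. q k < v" n] Wmono[of "\<lambda>k. q k \<le> u" "\<lambda>k. q k \<le> v"] that
      by (force simp: J_def)
  qed
  have "(F has_integral (f b - f a)) (cbox a b)"
    unfolding has_integral
  proof (intro allI impI)
    fix e :: real assume "e > 0"
    define c where "c = e / (b - a + 5)"
    have c: "c > 0" "c * (b - a + 4) < e"
      using \<open>e > 0\<close> \<open>a \<le> b\<close> by (auto simp: c_def field_simps)
    have local_bound: "\<exists>d>0. \<forall>u v. u \<in> {a..b} \<and> v \<in> {a..b} \<and> u \<le> x \<and> x \<le> v \<and> dist u x < d \<and> dist v x < d
        \<longrightarrow> norm ((v - u) *\<^sub>R F x - (f v - f u)) \<le> c * ((v + J v) - (u + J u))"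
      if x: "x \<in> {a..b}" for x
    proof (cases "x \<in> E")
      case True
      then obtain n where n: "q n = x"
        using from_nat_into_surj[OF E(1) True] by (auto simp: q_def)
      have "c * (1/2)^n / 2 > 0" using c by simp
      then obtain d where d: "d > 0"
          "\<And>y. y \<in> {a..b} \<Longrightarrow> dist y x < d \<Longrightarrow> dist (f y) (f x) < c * (1/2)^n / 2"
        using cont x unfolding continuous_on_iff by blast
      have "norm ((v - u) *\<^sub>R F x - (f v - f u)) \<le> c * ((v + J v) - (u + J u))"
        if "u \<in> {a..b}" "v \<in> {a..b}" "u \<le> x" "x \<le> v" "dist u x < d" "dist v x < d" for u v
      proof (cases "u = v")
        case False
        then have uv: "u < v" using that by auto
        have "norm (f v - f u) \<le> norm (f v - f x) + norm (f u - f x)"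
          using norm_triangle_ineq4[of "f v - f x" "f u - f x"] by simp
        also have "\<dots> \<le> c * (1/2)^n"
          using d(2)[of u] d(2)[of v] that by (simp add: dist_norm)
        also have "\<dots> \<le> c * ((v + J v) - (u + J u))"
          using Jjump[of u n v] n that uv c by (intro mult_left_mono) auto
        finally show ?thesis using True by (simp add: F_def norm_minus_commute)
      qed simp
      then show ?thesis using d(1) by blast
    next
      case False
      then have xin: "x \<in> {a<..<b} - D" "x \<in> {a..b}" using x by (auto simp: E_def)
      then have "(f has_vector_derivative f' x) (at x)" using deriv by blast
      then have "(f has_derivative (\<lambda>t. t *\<^sub>R f' x)) (at x within UNIV)"
        by (simp add: has_vector_derivative_def)
      then obtain d where d: "d > 0" "\<And>y. norm (y - x) < d \<Longrightarrow>
          norm (f y - f x - (y - x) *\<^sub>R f' x) \<le> c * norm (y - x)"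
        using c(1) unfolding has_derivative_within_alt by blast
      have "norm ((v - u) *\<^sub>R F x - (f v - f u)) \<le> c * ((v + J v) - (u + J u))"
        if "u \<in> {a..b}" "v \<in> {a..b}" "u \<le> x" "x \<le> v" "dist u x < d" "dist v x < d" for u v
      proof -
        have "(v - u) *\<^sub>R f' x - (f v - f u)
            = (f u - f x - (u - x) *\<^sub>R f' x) - (f v - f x - (v - x) *\<^sub>R f' x)"
          by (simp add: algebra_simps)
        then have "norm ((v - u) *\<^sub>R f' x - (f v - f u))
            \<le> norm (f u - f x - (u - x) *\<^sub>R f' x) + norm (f v - f x - (v - x) *\<^sub>R f' x)"
          by (metis norm_triangle_ineq4)
        also have "\<dots> \<le> c * norm (u - x) + c * norm (v - x)"
          using that by (intro add_mono d(2)) (auto simp: dist_norm)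
        also have "\<dots> = c * (v - u)" using that by (simp add: algebra_simps)
        also have "\<dots> \<le> c * ((v + J v) - (u + J u))"
          using Jmono[of u v] that c by (intro mult_left_mono) auto
        finally show ?thesis using False by (simp add: F_def)
      qed
      then show ?thesis using d(1) by blast
    qed
    then have "\<forall>x. \<exists>d>0. x \<in> {a..b} \<longrightarrow> (\<forall>u v. u \<in> {a..b} \<and> v \<in> {a..b} \<and> u \<le> x \<and> x \<le> v \<and> dist u x < d \<and> dist v x < d
        \<longrightarrow> norm ((v - u) *\<^sub>R F x - (f v - f u)) \<le> c * ((v + J v) - (u + J u)))"
      by (metis zero_less_one)
    then obtain d where d: "\<And>x. d x > 0"
      "\<And>x u v. \<lbrakk>x \<in> {a..b}; u \<in> {a..b}; v \<in> {a..b}; u \<le> x; x \<le> v; dist u x < d x; dist v x < d x\<rbrakk>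
        \<Longrightarrow> norm ((v - u) *\<^sub>R F x - (f v - f u)) \<le> c * ((v + J v) - (u + J u))"
      by metis
    show "\<exists>\<gamma>. gauge \<gamma> \<and> (\<forall>\<D>. \<D> tagged_division_of cbox a b \<and> \<gamma> fine \<D> \<longrightarrow>
        norm ((\<Sum>(x,k)\<in>\<D>. measure lborel k *\<^sub>R F x) - (f b - f a)) < e)"
    proof (rule exI, safe)
      show "gauge (\<lambda>x. ball x (d x))" using d(1) gauge_ball_dependent by blast
    next
      fix p assume p: "p tagged_division_of cbox a b" "(\<lambda>x. ball x (d x)) fine p"
      have fb: "f b - f a = (\<Sum>(x,K)\<in>p. f (Sup K) - f (Inf K))"
        using additive_tagged_division_1[of a b p f] \<open>a \<le> b\<close> p by auto
      have Jb: "(b + J b) - (a + J a) = (\<Sum>(x,K)\<in>p. (Sup K + J (Sup K)) - (Inf K + J (Inf K)))"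
        using additive_tagged_division_1[of a b p "\<lambda>y. y + J y"] \<open>a \<le> b\<close> p by auto
      have "norm (\<Sum>(x,K)\<in>p. measure lborel K *\<^sub>R F x - (f (Sup K) - f (Inf K)))
          \<le> (\<Sum>(x,K)\<in>p. c * ((Sup K + J (Sup K)) - (Inf K + J (Inf K))))"
      proof (rule sum_norm_le, safe)
        fix x K assume xK: "(x, K) \<in> p"
        then have "x \<in> K" and Kab: "K \<subseteq> cbox a b" using p by blast+
        then obtain u v where K: "K = cbox u v" using p xK by auto
        have uv: "u \<le> x" "x \<le> v" using \<open>x \<in> K\<close> K by auto
        have ball: "\<forall>y\<in>K. y \<in> ball x (d x)" using p(2) xK by blast
        have "u \<in> K" "v \<in> K" using uv K by auto
        then have "norm ((v - u) *\<^sub>R F x - (f v - f u)) \<le> c * ((v + J v) - (u + J u))"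
          using ball Kab \<open>x \<in> K\<close> uv by (intro d(2)) (auto simp: dist_commute)
        then show "norm (measure lborel K *\<^sub>R F x - (f (Sup K) - f (Inf K)))
            \<le> c * (Sup K + J (Sup K) - (Inf K + J (Inf K)))"
          using uv K by simp
      qed
      also have "\<dots> = c * ((b + J b) - (a + J a))"
        unfolding Jb by (simp add: sum_distrib_left case_prod_unfold)
      also have "\<dots> \<le> c * (b - a + 4)"
        using J0[of a] J4[of b] c by (intro mult_left_mono) auto
      also have "\<dots> < e" by (rule c)
      finally show "norm ((\<Sum>(x,k)\<in>p. measure lborel k *\<^sub>R F x) - (f b - f a)) < e"
        unfolding fb by (simp add: sum_subtractf case_prod_unfold)
    qed
  qed
  then have "(F has_integral (f b - f a)) {a..b}" by simp
  then show ?thesis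
    by (rule has_integral_spike[rotated 2, where S=E]) (auto simp: F_def negligible_iff_null_sets countable_imp_null_set_lborel[OF E(1)] null_sets_completionI)
qed

section \<open>The state transition function and variation of constants\<close>

lemma state_transitionD:
  assumes "state_transition N h a ad \<Psi>"
  shows "continuous_on {0..} \<Psi>" "\<Psi> 0 = 1" "\<And>t. t < 0 \<Longrightarrow> \<Psi> t = 0"
    and "\<exists>D. countable D \<and> (\<forall>t. t > 0 \<and> t \<notin> D \<longrightarrow>
          (\<Psi> has_real_derivative a * \<Psi> t + (\<Sum>j=1..N. ad j * \<Psi> (t - real j * h))) (at t))"
  using assms by (auto simp: state_transition_def satisfies_dde_def)

lemma state_transition_borel:
  assumes "state_transition N h a ad \<Psi>"
  shows "\<Psi> \<in> borel_measurable borel"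
proof -
  have "(\<lambda>t. if t \<in> {0..} then \<Psi> t else 0) \<in> borel_measurable borel"
    by (rule borel_measurable_continuous_on_if)
      (auto intro: state_transitionD[OF assms] continuous_intros)
  also have "(\<lambda>t. if t \<in> {0..} then \<Psi> t else 0) = \<Psi>"
    using state_transitionD[OF assms] by (auto simp: fun_eq_iff)
  finally show ?thesis .
qed

lemma state_transition_bounded:
  assumes "state_transition N h a ad \<Psi>"
  shows "\<exists>B\<ge>0. \<forall>t\<le>T. \<bar>\<Psi> t\<bar> \<le> B"
proof -
  have "compact (\<Psi> ` {0..T})"
    by (intro compact_continuous_image continuous_on_subset[OF state_transitionD(1)[OF assms]]) auto
  then obtain B where B: "\<And>t. t \<in> {0..T} \<Longrightarrow> \<bar>\<Psi> t\<bar> \<le> B"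
    by (force dest!: compact_imp_bounded simp: bounded_iff)
  have "\<bar>\<Psi> t\<bar> \<le> max B 0" if "t \<le> T" for t
    using B[of t] state_transitionD(3)[OF assms, of t] that by (cases "t < 0") auto
  then show ?thesis by (intro exI[of _ "max B 0"]) auto
qed

lemma state_transition_comp_product_integrable:
  fixes g :: "real \<Rightarrow> complex"
  assumes \<Psi>: "state_transition N h a ad \<Psi>" and g: "g absolutely_integrable_on {p..q}"
    and w: "w \<in> borel_measurable borel" "\<And>\<tau>. \<tau> \<in> {p..q} \<Longrightarrow> w \<tau> \<le> T"
  shows "(\<lambda>\<tau>. of_real (\<Psi> (w \<tau>)) * g \<tau>) absolutely_integrable_on {p..q}"
proof (rule absolutely_integrable_bounded_measurable_product[OF bilinear_times _ _ _ g])
  have "(\<lambda>\<tau>. complex_of_real (\<Psi> (w \<tau>))) \<in> borel_measurable borel"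
    using state_transition_borel[OF \<Psi>] w(1) by measurable
  then show "(\<lambda>\<tau>. complex_of_real (\<Psi> (w \<tau>))) \<in> borel_measurable (lebesgue_on {p..q})"
    by (intro measurable_restrict_space1 measurable_completion) simp
  obtain B where "\<And>t. t \<le> T \<Longrightarrow> \<bar>\<Psi> t\<bar> \<le> B"
    using state_transition_bounded[OF \<Psi>] by blast
  then show "bounded ((\<lambda>\<tau>. complex_of_real (\<Psi> (w \<tau>))) ` {p..q})"
    using w(2) by (intro boundedI[of _ B]) auto
qed auto

lemma state_transition_product_integrable:
  fixes g :: "real \<Rightarrow> complex"
  assumes "state_transition N h a ad \<Psi>" and "g absolutely_integrable_on {p..q}"
  shows "(\<lambda>\<tau>. of_real (\<Psi> (c - \<tau>)) * g \<tau>) absolutely_integrable_on {p..q}"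
  by (rule state_transition_comp_product_integrable[OF assms, where T="c - p"]) auto

lemma state_transition_comp_integrable:
  fixes w :: "real \<Rightarrow> real"
  assumes "state_transition N h a ad \<Psi>"
    and "w \<in> borel_measurable borel" "\<And>\<tau>. \<tau> \<in> {p..q} \<Longrightarrow> w \<tau> \<le> T"
  shows "(\<lambda>\<tau>. complex_of_real (\<Psi> (w \<tau>))) absolutely_integrable_on {p..q}"
proof -
  have "(\<lambda>_. 1 :: complex) absolutely_integrable_on {p..q}"
    by (intro absolutely_integrable_continuous_real continuous_intros)
  from state_transition_comp_product_integrable[where T=T, OF assms(1) this assms(2)] assms(3)
  show ?thesis by simp
qed

text \<open>
  Integrate the derivative of \<open>\<tau> \<mapsto> \<Psi> (t - \<tau>) * y \<tau>\<close>: the terms with \<open>a\<close> cancel, and each delay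
  contributes the difference of one integrand and its translate by \<open>j h\<close>. Since \<open>\<Psi>\<close> vanishes
  on the negative axis, only the integral over the initial interval survives.
\<close>

lemma variation_of_constants:
  fixes y f :: "real \<Rightarrow> complex"
  assumes h: "h > 0" and \<Psi>: "state_transition N h a ad \<Psi>"
    and cont: "continuous_on {0..} y"
    and "countable D"
    and deriv: "\<And>t. t > 0 \<Longrightarrow> t \<notin> D \<Longrightarrow> (y has_vector_derivative
        (of_real a * y t + (\<Sum>j=1..N. of_real (ad j) * y (t - real j * h)) + f t)) (at t)"
    and hist: "y absolutely_integrable_on {- (real N * h)..0}"
    and t: "t \<ge> 0"
  shows "((\<lambda>\<tau>. of_real (\<Psi> (t - \<tau>)) * f \<tau>) has_integral
      (y t - of_real (\<Psi> t) * y 0 - (\<Sum>j=1..N. of_real (ad j) *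
        integral {- (real j * h)..0} (\<lambda>\<tau>. of_real (\<Psi> (t - real j * h - \<tau>)) * y \<tau>)))) {0..t}"
proof -
  define P where "P \<tau> = complex_of_real (\<Psi> \<tau>)" for \<tau>
  obtain E where E: "countable E" "\<And>t. t > 0 \<Longrightarrow> t \<notin> E \<Longrightarrow>
      (\<Psi> has_real_derivative a * \<Psi> t + (\<Sum>j=1..N. ad j * \<Psi> (t - real j * h))) (at t)"
    using state_transitionD(4)[OF \<Psi>] by blast
  have P_cont: "continuous_on {0..} P"
    unfolding P_def by (intro continuous_intros state_transitionD(1)[OF \<Psi>])
  define G where "G \<tau> = (\<Sum>j=1..N. of_real (ad j) * (P (t - \<tau>) * y (\<tau> - real j * h)
      - P (t - real j * h - \<tau>) * y \<tau>)) + P (t - \<tau>) * f \<tau>" for \<tau>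
  have "(G has_integral (P (t - t) * y t - P (t - 0) * y 0)) {0..t}"
  proof (rule fundamental_theorem_of_calculus_countable[of "D \<union> (\<lambda>s. t - s) ` E" 0 t])
    show "countable (D \<union> (\<lambda>s. t - s) ` E)" using \<open>countable D\<close> E(1) by auto
    have "continuous_on {0..t} (\<lambda>\<tau>. P (t - \<tau>))"
      by (rule continuous_on_compose2[OF P_cont]) (auto intro!: continuous_intros)
    then show "continuous_on {0..t} (\<lambda>\<tau>. P (t - \<tau>) * y \<tau>)"
      by (intro continuous_intros continuous_on_subset[OF cont]) auto
    fix \<tau> assume \<tau>: "\<tau> \<in> {0<..<t} - (D \<union> (\<lambda>s. t - s) ` E)"
    then have "t - \<tau> \<notin> E" by force
    then have "(\<Psi> has_real_derivative a * \<Psi> (t - \<tau>) + (\<Sum>j=1..N. ad j * \<Psi> (t - \<tau> - real j * h))) (at (t - \<tau>))"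
      using E(2) \<tau> by auto
    then have "((\<lambda>\<tau>. \<Psi> (t - \<tau>)) has_real_derivative
        (a * \<Psi> (t - \<tau>) + (\<Sum>j=1..N. ad j * \<Psi> (t - \<tau> - real j * h))) * (-1)) (at \<tau>)"
      by (rule DERIV_chain2) (auto intro!: derivative_eq_intros)
    then have "((\<lambda>\<tau>. P (t - \<tau>)) has_vector_derivative
        of_real ((a * \<Psi> (t - \<tau>) + (\<Sum>j=1..N. ad j * \<Psi> (t - \<tau> - real j * h))) * (-1))) (at \<tau>)"
      unfolding P_def by (rule has_vector_derivative_of_real)
    from has_vector_derivative_mult[OF this deriv[of \<tau>]]
    show "((\<lambda>\<tau>. P (t - \<tau>) * y \<tau>) has_vector_derivative G \<tau>) (at \<tau>)"
      using \<tau> by (simp add: G_def P_def algebra_simps sum_subtractf sum_negf sum_distrib_left sum_distrib_right)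
  qed (rule t)
  then have G_int: "(G has_integral (y t - P t * y 0)) {0..t}"
    using state_transitionD(2)[OF \<Psi>] by (simp add: P_def)
  have delay: "((\<lambda>\<tau>. P (t - \<tau>) * y (\<tau> - real j * h) - P (t - real j * h - \<tau>) * y \<tau>)
      has_integral (integral {- (real j * h)..0} (\<lambda>\<tau>. P (t - real j * h - \<tau>) * y \<tau>))) {0..t}"
    if j: "j \<in> {1..N}" for j
  proof -
    define d where "d = real j * h"
    have d: "d > 0" "d \<le> real N * h" using j h by (auto simp: d_def)
    define H where "H \<tau> = P (t - d - \<tau>) * y \<tau>" for \<tau>
    have left: "H integrable_on {-d..0}"
      unfolding H_def P_def
      by (intro set_lebesgue_integral_eq_integral(1) state_transition_product_integrable[OF \<Psi>]
          absolutely_integrable_on_subinterval[OF hist]) (use d in auto)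
    have right: "H integrable_on {0..t}"
      unfolding H_def P_def
      by (intro set_lebesgue_integral_eq_integral(1) state_transition_product_integrable[OF \<Psi>]
          absolutely_integrable_continuous_real continuous_on_subset[OF cont]) auto
    have whole: "H integrable_on {-d..t}"
      using Henstock_Kurzweil_Integration.integrable_combine[OF _ t left right] d by simp
    have beyond: "integral {t-d..t} H = 0"
      by (rule integral_unique, rule has_integral_spike_finite[where S="{t-d}" and f="\<lambda>_. 0"])
        (auto simp: H_def P_def state_transitionD(3)[OF \<Psi>])
    have "integral {-d..t-d} H = integral {-d..0} H + integral {0..t} H"
      using Henstock_Kurzweil_Integration.integral_combine[OF _ _ whole, of "t-d"]
        Henstock_Kurzweil_Integration.integral_combine[OF _ _ whole, of 0] beyond d t
      by simp
    moreover have "H integrable_on {-d..t-d}"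
      by (rule integrable_on_subinterval[OF whole]) (use d in auto)
    ultimately have "(H has_integral (integral {-d..0} H + integral {0..t} H)) {-d..t-d}"
      by (metis integrable_integral)
    from has_integral_shift_real_ivl[OF this, of "-d"]
    have "((\<lambda>\<tau>. H (\<tau> - d)) has_integral (integral {-d..0} H + integral {0..t} H)) {0..t}"
      by simp
    from has_integral_diff[OF this integrable_integral[OF right]]
    show ?thesis by (simp add: H_def[abs_def] d_def)
  qed
  have "((\<lambda>\<tau>. \<Sum>j=1..N. of_real (ad j) * (P (t - \<tau>) * y (\<tau> - real j * h)
      - P (t - real j * h - \<tau>) * y \<tau>)) has_integral (\<Sum>j=1..N. of_real (ad j) *
        integral {- (real j * h)..0} (\<lambda>\<tau>. P (t - real j * h - \<tau>) * y \<tau>))) {0..t}"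
    by (intro has_integral_sum has_integral_mult_right delay) auto
  from has_integral_diff[OF G_int this] show ?thesis
    by (simp add: G_def P_def)
qed

text \<open>
  Up to time \<open>h\<close> every delayed argument is negative, so the equation is \<open>\<Psi>' = a \<Psi>\<close> there.
\<close>

lemma state_transition_first_delay:
  assumes h: "h > 0" and \<Psi>: "state_transition N h a ad \<Psi>" and t: "0 \<le> t" "t \<le> h"
  shows "\<Psi> t = exp (a * t)"
proof -
  obtain E where E: "countable E" "\<And>t. t > 0 \<Longrightarrow> t \<notin> E \<Longrightarrow>
      (\<Psi> has_real_derivative a * \<Psi> t + (\<Sum>j=1..N. ad j * \<Psi> (t - real j * h))) (at t)"
    using state_transitionD(4)[OF \<Psi>] by blast
  have "((\<lambda>_. 0) has_integral (exp (- (a * t)) * \<Psi> t - exp (- (a * 0)) * \<Psi> 0)) {0..t}"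
  proof (rule fundamental_theorem_of_calculus_countable[OF E(1) t(1)])
    show "continuous_on {0..t} (\<lambda>t. exp (- (a * t)) * \<Psi> t)"
      by (intro continuous_intros continuous_on_subset[OF state_transitionD(1)[OF \<Psi>]]) auto
    fix s assume s: "s \<in> {0<..<t} - E"
    have "\<Psi> (s - real j * h) = 0" if "j \<in> {1..N}" for j
    proof -
      have "h \<le> real j * h" using mult_right_mono[of 1 "real j" h] that h by simp
      then have "s - real j * h < 0" using s t by (simp only: greaterThanLessThan_iff Diff_iff) linarith
      then show ?thesis by (rule state_transitionD(3)[OF \<Psi>])
    qed
    then have "(\<Psi> has_real_derivative a * \<Psi> s) (at s)" using E(2)[of s] s by simp
    then have "((\<lambda>t. exp (- (a * t)) * \<Psi> t) has_real_derivative 0) (at s)"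
      by (auto intro!: derivative_eq_intros)
    then show "((\<lambda>t. exp (- (a * t)) * \<Psi> t) has_vector_derivative 0) (at s)"
      by (simp add: has_real_derivative_iff_has_vector_derivative)
  qed
  then have "exp (- (a * t)) * \<Psi> t = 1"
    using has_integral_unique[OF _ has_integral_0] state_transitionD(2)[OF \<Psi>] by fastforce
  then show ?thesis by (simp add: exp_minus field_simps)
qed

section \<open>Integrals: bounded convergence, residues and elementary bounds\<close>

text \<open>
  The point \<open>z\<close> allows for the jump of \<open>\<Psi>\<close>, at which the partial sums are only known to be
  bounded.
\<close>

lemma bounded_convergence_product_integral:
  fixes f L :: "real \<Rightarrow> complex" and v :: "nat \<Rightarrow> real \<Rightarrow> complex"
  assumes f: "f absolutely_integrable_on {p..q}"
    and cont: "\<And>n. continuous_on {p..q} (v n)"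
    and bound: "eventually (\<lambda>n. \<forall>\<tau>\<in>{p..q}. norm (v n \<tau>) \<le> B) sequentially"
    and lim: "\<And>\<tau>. \<tau> \<in> {p..q} \<Longrightarrow> \<tau> \<noteq> z \<Longrightarrow> (\<lambda>n. v n \<tau>) \<longlonglongrightarrow> L \<tau>"
  shows "(\<lambda>n. integral {p..q} (\<lambda>\<tau>. f \<tau> * v n \<tau>)) \<longlonglongrightarrow> integral {p..q} (\<lambda>\<tau>. f \<tau> * L \<tau>)"
proof -
  obtain n0 where n0: "\<forall>n\<ge>n0. \<forall>\<tau>\<in>{p..q}. norm (v n \<tau>) \<le> B"
    using bound unfolding eventually_sequentially by blast
  define F where "F k \<tau> = (if \<tau> = z then 0 else f \<tau> * v (k + n0) \<tau>)" for k \<tau>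
  have prod: "(\<lambda>\<tau>. v n \<tau> * f \<tau>) absolutely_integrable_on {p..q}" for n
  proof (rule absolutely_integrable_bounded_measurable_product[OF bilinear_times _ _ _ f])
    show "v n \<in> borel_measurable (lebesgue_on {p..q})"
      by (rule continuous_imp_measurable_on_sets_lebesgue[OF cont]) auto
    show "bounded (v n ` {p..q})"
      by (intro compact_imp_bounded compact_continuous_image cont) auto
  qed auto
  then have prod': "(\<lambda>\<tau>. f \<tau> * v n \<tau>) integrable_on {p..q}" for n
    using set_lebesgue_integral_eq_integral(1)[OF prod[of n]] by (simp add: mult.commute)
  have "(\<lambda>k. integral {p..q} (F k)) \<longlonglongrightarrow> integral {p..q} (\<lambda>\<tau>. if \<tau> = z then 0 else f \<tau> * L \<tau>)"
  proof (rule dominated_convergence(2))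
    show "F k integrable_on {p..q}" for k
      by (rule integrable_spike[OF prod'[of "k + n0"], of "{z}"]) (auto simp: F_def)
    show "(\<lambda>\<tau>. norm (f \<tau>) * \<bar>B\<bar>) integrable_on {p..q}"
      using f unfolding absolutely_integrable_on_def by (intro integrable_on_mult_left) auto
    show "norm (F k \<tau>) \<le> norm (f \<tau>) * \<bar>B\<bar>" if "\<tau> \<in> {p..q}" for k \<tau>
    proof -
      have "norm (v (k + n0) \<tau>) \<le> \<bar>B\<bar>" using n0[rule_format, of "k + n0" \<tau>] that by simp
      then show ?thesis by (simp add: F_def norm_mult mult_left_mono)
    qed
    show "(\<lambda>k. F k \<tau>) \<longlonglongrightarrow> (if \<tau> = z then 0 else f \<tau> * L \<tau>)" if "\<tau> \<in> {p..q}" for \<tau>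
      using LIMSEQ_ignore_initial_segment[OF lim[OF that], of n0]
      by (auto simp: F_def intro!: tendsto_mult)
  qed
  also have "integral {p..q} (\<lambda>\<tau>. if \<tau> = z then 0 else f \<tau> * L \<tau>) = integral {p..q} (\<lambda>\<tau>. f \<tau> * L \<tau>)"
    by (rule integral_spike[of "{z}"]) auto
  also have "(\<lambda>k. integral {p..q} (F k)) = (\<lambda>k. integral {p..q} (\<lambda>\<tau>. f \<tau> * v (k + n0) \<tau>))"
  proof
    show "integral {p..q} (F k) = integral {p..q} (\<lambda>\<tau>. f \<tau> * v (k + n0) \<tau>)" for k
      by (rule integral_spike[of "{z}"]) (auto simp: F_def)
  qed
  finally show ?thesis by (rule LIMSEQ_offset)
qed

lemma simple_zeros_finite:
  fixes D D' :: "complex \<Rightarrow> complex"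
  assumes deriv: "\<And>s. (D has_field_derivative D' s) (at s)"
    and simple: "\<And>s. D s = 0 \<Longrightarrow> D' s \<noteq> 0"
    and "compact K"
  shows "finite {z \<in> K. D z = 0}"
proof (cases "D constant_on UNIV")
  case True
  then obtain c where c: "\<And>z. D z = c" by (auto simp: constant_on_def)
  then have "D = (\<lambda>_. c)" by auto
  then have "D' s = 0" for s using deriv[of s] DERIV_const DERIV_unique by blast
  then have "{z \<in> K. D z = 0} = {}" using simple by auto
  then show ?thesis by (metis finite.emptyI)
next
  case False
  have "D holomorphic_on UNIV"
    using deriv by (meson DERIV_subset field_differentiable_def holomorphic_on_def subset_UNIV)
  from holomorphic_compact_finite_zeros[OF this open_UNIV connected_UNIV assms(3) _ False]
  show ?thesis by simp
qed

text \<open>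
  The function \<open>exp (s * t) / D s\<close> may have infinitely many poles, so the residue theorem is
  applied on a ball that contains the square; the poles in the ball but outside the square
  have winding number \<open>0\<close>.
\<close>

lemma square_contour_residues:
  fixes D D' :: "complex \<Rightarrow> complex"
  assumes deriv: "\<And>s. (D has_field_derivative D' s) (at s)"
    and simple: "\<And>s. D s = 0 \<Longrightarrow> D' s \<noteq> 0"
    and "R > 0"
    and boundary: "\<And>s. s \<in> cbox (Complex (-R) (-R)) (Complex R R) - box (Complex (-R) (-R)) (Complex R R) \<Longrightarrow> D s \<noteq> 0"
  shows "contour_integral (rectpath (Complex (-R) (-R)) (Complex R R)) (\<lambda>s. exp (s * of_real t) / D s)
    = 2 * of_real pi * \<i> * (\<Sum>p | D p = 0 \<and> p \<in> box (Complex (-R) (-R)) (Complex R R). exp (p * of_real t) / D' p)"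
proof -
  define Q where "Q = box (Complex (-R) (-R)) (Complex R R)"
  define Qc where "Qc = cbox (Complex (-R) (-R)) (Complex R R)"
  have holo: "D holomorphic_on A" for A
    using deriv by (meson DERIV_subset field_differentiable_def holomorphic_on_def subset_UNIV)
  have Q_sub: "Q \<subseteq> Qc" unfolding Q_def Qc_def by (rule box_subset_cbox)
  define B where "B = ball (0::complex) (3 * R)"
  define pts where "pts = {z \<in> cball 0 (3 * R). D z = 0}"
  have fin: "finite pts" unfolding pts_def by (rule simple_zeros_finite[OF deriv simple]) auto
  have Qc_sub: "Qc \<subseteq> B"
  proof
    fix z assume "z \<in> Qc"
    then have "\<bar>Re z\<bar> \<le> R" "\<bar>Im z\<bar> \<le> R" by (auto simp: Qc_def in_cbox_complex_iff)
    then have "norm z \<le> 2 * R" using cmod_le[of z] by linarith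
    then show "z \<in> B" using \<open>R > 0\<close> by (simp add: B_def)
  qed
  define g where "g = rectpath (Complex (-R) (-R)) (Complex R R)"
  have img: "path_image g = Qc - Q"
    unfolding g_def Qc_def Q_def by (rule path_image_rectpath_cbox_minus_box) (use \<open>R > 0\<close> in auto)
  have outside: "winding_number g z = 0" if "z \<notin> Qc" for z
    unfolding g_def by (rule winding_number_rectpath_outside) (use that \<open>R > 0\<close> in \<open>auto simp: Qc_def\<close>)
  have "contour_integral g (\<lambda>s. exp (s * of_real t) / D s)
      = 2 * pi * \<i> * (\<Sum>p\<in>pts. winding_number g p * residue (\<lambda>s. exp (s * of_real t) / D s) p)"
  proof (rule Residue_theorem[of B])
    show "(\<lambda>s. exp (s * of_real t) / D s) holomorphic_on B - pts"
      by (intro holomorphic_intros holo) (auto simp: pts_def B_def)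
    show "path_image g \<subseteq> B - pts"
      using img Qc_sub boundary by (auto simp: pts_def Qc_def Q_def)
    show "\<forall>z. z \<notin> B \<longrightarrow> winding_number g z = 0" using outside Qc_sub by auto
  qed (use fin in \<open>auto simp: B_def g_def\<close>)
  also have "(\<Sum>p\<in>pts. winding_number g p * residue (\<lambda>s. exp (s * of_real t) / D s) p)
      = (\<Sum>p\<in>{p. D p = 0 \<and> p \<in> Q}. exp (p * of_real t) / D' p)"
  proof (rule sum.mono_neutral_cong_right[OF fin])
    show "{p. D p = 0 \<and> p \<in> Q} \<subseteq> pts" using Q_sub Qc_sub by (force simp: pts_def B_def)
    show "\<forall>p\<in>pts - {p. D p = 0 \<and> p \<in> Q}. winding_number g p * residue (\<lambda>s. exp (s * of_real t) / D s) p = 0"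
    proof
      fix p assume "p \<in> pts - {p. D p = 0 \<and> p \<in> Q}"
      then have "p \<notin> Qc" using boundary[of p] by (auto simp: pts_def Qc_def Q_def)
      then show "winding_number g p * residue (\<lambda>s. exp (s * of_real t) / D s) p = 0"
        by (simp add: outside)
    qed
    fix p assume p: "p \<in> {p. D p = 0 \<and> p \<in> Q}"
    have "winding_number g p = 1"
      unfolding g_def by (rule winding_number_rectpath) (use p in \<open>simp add: Q_def\<close>)
    moreover have "residue (\<lambda>s. exp (s * of_real t) / D s) p = exp (p * of_real t) / D' p"
      by (rule residue_simple_pole_deriv[where s=UNIV])
        (use p deriv simple holo in \<open>auto intro!: holomorphic_intros\<close>)
    ultimately show "winding_number g p * residue (\<lambda>s. exp (s * of_real t) / D s) p
        = exp (p * of_real t) / D' p" by simp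
  qed
  finally show "contour_integral (rectpath (Complex (-R) (-R)) (Complex R R)) (\<lambda>s. exp (s * of_real t) / D s)
    = 2 * of_real pi * \<i> * (\<Sum>p | D p = 0 \<and> p \<in> box (Complex (-R) (-R)) (Complex R R). exp (p * of_real t) / D' p)"
    by (simp add: g_def Q_def)
qed

lemma contour_integral_bound_horizontal:
  assumes "x0 < x1" and cont: "continuous_on (closed_segment (Complex x0 c) (Complex x1 c)) f"
    and bound: "\<And>x. x \<in> {x0..x1} \<Longrightarrow> norm (f (Complex x c)) \<le> g x"
    and g: "(g has_integral G) {x0..x1}"
  shows "norm (contour_integral (linepath (Complex x0 c) (Complex x1 c)) f) \<le> G"
proof -
  let ?z0 = "Complex x0 c" and ?z1 = "Complex x1 c"
  have "((\<lambda>x. g ((x1 - x0) *\<^sub>R x + x0)) has_integral G /\<^sub>R (x1 - x0) ^ DIM(real))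
      (cbox ((x0 - x0) /\<^sub>R (x1 - x0)) ((x1 - x0) /\<^sub>R (x1 - x0)))"
    by (rule has_integral_affinity') (use g \<open>x0 < x1\<close> in auto)
  then have "((\<lambda>x. g ((x1 - x0) * x + x0)) has_integral G / (x1 - x0)) {0..1}"
    using \<open>x0 < x1\<close> by (simp add: divide_inverse mult.commute)
  from has_integral_mult_left[OF this, of "x1 - x0"]
  have g01: "((\<lambda>x. g ((x1 - x0) * x + x0) * (x1 - x0)) has_integral G) {0..1}"
    using \<open>x0 < x1\<close> by simp
  have "f contour_integrable_on linepath ?z0 ?z1"
    by (rule contour_integrable_continuous_linepath[OF cont])
  then have I: "((\<lambda>x. f (linepath ?z0 ?z1 x) * (?z1 - ?z0)) has_integral
      contour_integral (linepath ?z0 ?z1) f) {0..1}"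
    using has_contour_integral_integral has_contour_integral_linepath by blast
  have "norm (integral {0..1} (\<lambda>x. f (linepath ?z0 ?z1 x) * (?z1 - ?z0)))
      \<le> integral {0..1} (\<lambda>x. g ((x1 - x0) * x + x0) * (x1 - x0))"
  proof (rule integral_norm_bound_integral)
    fix x :: real assume x: "x \<in> {0..1}"
    have lp: "linepath ?z0 ?z1 x = Complex ((x1 - x0) * x + x0) c"
      by (simp add: linepath_def complex_eq_iff algebra_simps)
    have "(x1 - x0) * x \<le> x1 - x0" using x \<open>x0 < x1\<close> by (simp add: mult_left_le)
    moreover have "0 \<le> (x1 - x0) * x" using x \<open>x0 < x1\<close> by simp
    ultimately have "(x1 - x0) * x + x0 \<in> {x0..x1}" unfolding atLeastAtMost_iff by linarith
    from bound[OF this] have "norm (f (linepath ?z0 ?z1 x)) \<le> g ((x1 - x0) * x + x0)"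
      unfolding lp .
    moreover have "norm (?z1 - ?z0) = x1 - x0" using \<open>x0 < x1\<close> by (simp add: cmod_eq_Re)
    ultimately show "norm (f (linepath ?z0 ?z1 x) * (?z1 - ?z0)) \<le> g ((x1 - x0) * x + x0) * (x1 - x0)"
      using \<open>x0 < x1\<close> by (simp add: norm_mult mult_right_mono)
  qed (use I g01 in \<open>auto simp: has_integral_integrable\<close>)
  then show ?thesis by (simp only: integral_unique[OF I] integral_unique[OF g01])
qed

lemma contour_integral_square_bound:
  assumes "R > 0"
    and cont: "continuous_on (path_image (rectpath (Complex (-R) (-R)) (Complex R R))) f"
    and horizontal: "\<And>s. \<bar>Im s\<bar> = R \<Longrightarrow> \<bar>Re s\<bar> \<le> R \<Longrightarrow> norm (f s) \<le> g (Re s)"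
    and g: "(g has_integral G) {-R..R}"
    and left: "\<And>s. Re s = - R \<Longrightarrow> \<bar>Im s\<bar> \<le> R \<Longrightarrow> norm (f s) \<le> L"
    and right: "\<And>s. Re s = R \<Longrightarrow> \<bar>Im s\<bar> \<le> R \<Longrightarrow> norm (f s) \<le> V"
  shows "norm (contour_integral (rectpath (Complex (-R) (-R)) (Complex R R)) f) \<le> 2 * G + 2 * R * (L + V)"
proof -
  define z1 z2 z3 z4 where "z1 = Complex (-R) (-R)" and "z2 = Complex R (-R)"
    and "z3 = Complex R R" and "z4 = Complex (-R) R"
  have rp: "rectpath (Complex (-R) (-R)) (Complex R R)
      = linepath z1 z2 +++ linepath z2 z3 +++ linepath z3 z4 +++ linepath z4 z1"
    by (simp add: rectpath_def Let_def z1_def z2_def z3_def z4_def)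
  have cs: "continuous_on (closed_segment z1 z2) f" "continuous_on (closed_segment z2 z3) f"
      "continuous_on (closed_segment z3 z4) f" "continuous_on (closed_segment z4 z1) f"
    by (rule continuous_on_subset[OF cont], simp add: rp path_image_join; blast)+
  note ci = cs[THEN contour_integrable_continuous_linepath]
  have split: "contour_integral (rectpath (Complex (-R) (-R)) (Complex R R)) f
      = contour_integral (linepath z1 z2) f + contour_integral (linepath z2 z3) f
        + contour_integral (linepath z3 z4) f + contour_integral (linepath z4 z1) f"
    unfolding rp by (simp add: ci)
  have hor: "norm (f (Complex x c)) \<le> g x" if "c \<in> {R, -R}" "x \<in> {-R..R}" for c x
    using horizontal[of "Complex x c"] that \<open>R > 0\<close> by (auto simp: abs_le_iff)
  have bottom: "norm (contour_integral (linepath z1 z2) f) \<le> G"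
    unfolding z1_def z2_def
    by (rule contour_integral_bound_horizontal[OF _ _ _ g])
      (use \<open>R > 0\<close> cs(1) hor in \<open>simp_all add: z1_def z2_def\<close>)
  have "norm (contour_integral (linepath z4 z3) f) \<le> G"
    unfolding z3_def z4_def
    by (rule contour_integral_bound_horizontal[OF _ _ _ g])
      (use \<open>R > 0\<close> cs(3) hor in \<open>simp_all add: z3_def z4_def closed_segment_commute\<close>)
  then have top: "norm (contour_integral (linepath z3 z4) f) \<le> G"
    using contour_integral_reverse_linepath[OF cs(3)] by simp
  have L0: "0 \<le> L" and V0: "0 \<le> V"
    using left[of z1] right[of z2] \<open>R > 0\<close> norm_ge_zero order_trans by (auto simp: z1_def z2_def; blast)+
  have "norm (contour_integral (linepath z2 z3) f) \<le> V * norm (z3 - z2)"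
    by (rule contour_integral_bound_linepath[OF ci(2) V0], rule right)
      (use \<open>R > 0\<close> in \<open>auto simp: z2_def z3_def closed_segment_same_Re closed_segment_eq_real_ivl\<close>)
  moreover have "norm (z3 - z2) = 2 * R" using \<open>R > 0\<close> by (simp add: z2_def z3_def cmod_eq_Im)
  ultimately have rgt: "norm (contour_integral (linepath z2 z3) f) \<le> 2 * R * V" by (simp add: mult.commute)
  have "norm (contour_integral (linepath z4 z1) f) \<le> L * norm (z1 - z4)"
    by (rule contour_integral_bound_linepath[OF ci(4) L0], rule left)
      (use \<open>R > 0\<close> in \<open>auto simp: z1_def z4_def closed_segment_same_Re closed_segment_eq_real_ivl\<close>)
  moreover have "norm (z1 - z4) = 2 * R" using \<open>R > 0\<close> by (simp add: z1_def z4_def cmod_eq_Im)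
  ultimately have lft: "norm (contour_integral (linepath z4 z1) f) \<le> 2 * R * L" by (simp add: mult.commute)
  show ?thesis
    unfolding split using bottom top lft rgt
    by (intro order_trans[OF norm_triangle_ineq] order_trans[OF add_mono[OF norm_triangle_ineq order_refl]])
      (smt (verit) norm_triangle_ineq distrib_left)
qed

lemma exp_neg_abs_integral:
  fixes c R :: real
  assumes "c \<ge> 0" "R \<ge> 0"
  shows "\<exists>J. ((\<lambda>x. exp (- (c * \<bar>x\<bar>))) has_integral J) {-R..R} \<and> J \<le> 2 * R \<and> (c > 0 \<longrightarrow> J \<le> 2 / c)"
proof -
  let ?f = "\<lambda>x::real. exp (- (c * \<bar>x\<bar>))"
  have int: "?f integrable_on {x..y}" for x y
    by (intro integrable_continuous_real continuous_intros)
  have "integral {-R..R} ?f \<le> integral {-R..R} (\<lambda>_. 1)"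
    by (rule integral_le[OF int]) (use assms in auto)
  then have "integral {-R..R} ?f \<le> 2 * R" using assms by simp
  moreover have "integral {-R..R} ?f \<le> 2 / c" if "c > 0"
  proof -
    have "((\<lambda>x. exp (c * x)) has_integral (exp (c * 0) / c - exp (c * (-R)) / c)) {-R..0}"
      by (rule fundamental_theorem_of_calculus)
        (use assms that in \<open>auto intro!: derivative_eq_intros simp flip: has_real_derivative_iff_has_vector_derivative\<close>)
    then have "(?f has_integral (exp (c * 0) / c - exp (c * (-R)) / c)) {-R..0}"
      by (rule has_integral_eq[rotated]) auto
    moreover have "((\<lambda>x. exp (- c * x)) has_integral (- exp (- c * R) / c - (- exp (- c * 0) / c))) {0..R}"
      by (rule fundamental_theorem_of_calculus)
        (use assms that in \<open>auto intro!: derivative_eq_intros simp flip: has_real_derivative_iff_has_vector_derivative\<close>)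
    then have "(?f has_integral (- exp (- c * R) / c - (- exp (- c * 0) / c))) {0..R}"
      by (rule has_integral_eq[rotated]) auto
    ultimately have "(?f has_integral ((exp (c * 0) / c - exp (c * (-R)) / c)
        + (- exp (- c * R) / c - (- exp (- c * 0) / c)))) {-R..R}"
      by (rule has_integral_combine[rotated 2]) (use assms in auto)
    then have "integral {-R..R} ?f = (2 - 2 * exp (- c * R)) / c"
      by (simp add: integral_unique diff_divide_distrib)
    also have "\<dots> \<le> 2 / c" using that by (intro divide_right_mono) auto
    finally show ?thesis .
  qed
  ultimately show ?thesis using integrable_integral[OF int] by blast
qed

text \<open>
  With \<open>u = \<alpha> exp (- k x) / R\<close> the left-hand side is at most \<open>exp (\<epsilon> x) / \<alpha>\<close> times
  \<open>u / (1 + u)\<close>, and \<open>u / (1 + u) \<le> u powr q\<close> for \<open>0 \<le> q \<le> 1\<close>. The choice of \<open>q\<close> spends half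
  of the exponential decay on a negative power of \<open>R\<close> and keeps the other half for
  integrability in \<open>x\<close>.
\<close>

lemma exp_over_sum_bound:
  fixes R \<alpha> k \<epsilon> x t :: real
  assumes "R > 0" "\<alpha> > 0" "0 < \<epsilon>" "\<epsilon> \<le> k" "x \<le> 0" "\<epsilon> - k \<le> t"
  shows "exp (x * t) / (R + \<alpha> * exp (- (k * x)))
    \<le> (1 / \<alpha>) * (\<alpha> / R) powr (\<epsilon> / (2 * k)) * exp (- (\<epsilon> / 2 * \<bar>x\<bar>))"
proof -
  define X where "X = exp (- (k * x))"
  define q where "q = \<epsilon> / (2 * k)"
  define u where "u = \<alpha> * X / R"
  have k: "k > 0" using assms by simp
  have q: "0 < q" "q \<le> 1" using assms k by (auto simp: q_def)
  have X: "X > 0" by (simp add: X_def)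
  have u: "u > 0" using assms X by (simp add: u_def)
  have uq: "u / (1 + u) \<le> u powr q"
  proof (cases "u \<le> 1")
    case True
    have "u / (1 + u) \<le> u" using u by (simp add: divide_simps) 
    also have "\<dots> = u powr 1" using u by simp
    also have "\<dots> \<le> u powr q" using True u q by (intro powr_mono') auto
    finally show ?thesis .
  next
    case False
    have "u / (1 + u) \<le> 1" using u by simp
    also have "\<dots> \<le> u powr q" using False q by (intro ge_one_powr_ge_zero) auto
    finally show ?thesis .
  qed
  have "x * t \<le> x * (\<epsilon> - k)" using assms by (intro mult_left_mono_neg)
  then have "exp (x * t) \<le> exp (x * \<epsilon>) * X"
    by (simp add: X_def algebra_simps flip: exp_add)
  then have "exp (x * t) / (R + \<alpha> * X) \<le> exp (x * \<epsilon>) * X / (R + \<alpha> * X)"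
    using assms X by (intro divide_right_mono) auto
  also have "\<dots> = exp (x * \<epsilon>) * (1 / \<alpha>) * (u / (1 + u))"
  proof -
    have "u / (1 + u) = \<alpha> * X / (R + \<alpha> * X)"
      using assms X by (simp add: u_def divide_simps add_pos_pos)
    then show ?thesis using assms by simp
  qed
  also have "\<dots> \<le> exp (x * \<epsilon>) * (1 / \<alpha>) * (u powr q)"
    by (rule mult_left_mono[OF uq]) (use assms in simp)
  also have "u powr q = (\<alpha> / R) powr q * X powr q"
    using assms X by (simp add: u_def flip: powr_mult)
  also have "X powr q = exp (- (x * \<epsilon> / 2))"
    unfolding X_def exp_powr_real using k by (simp add: q_def)
  also have "exp (x * \<epsilon>) * (1 / \<alpha>) * ((\<alpha> / R) powr q * exp (- (x * \<epsilon> / 2)))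
      = (1 / \<alpha>) * (\<alpha> / R) powr q * (exp (x * \<epsilon>) * exp (- (x * \<epsilon> / 2)))" by simp
  also have "exp (x * \<epsilon>) * exp (- (x * \<epsilon> / 2)) = exp (- (\<epsilon> / 2 * \<bar>x\<bar>))"
    using assms by (simp flip: exp_add)
  finally show ?thesis by (simp only: X_def q_def)
qed

section \<open>Size of the characteristic function\<close>

lemma lower_powers_bound:
  fixes c :: "nat \<Rightarrow> real"
  assumes "\<eta> > 0" and c: "\<And>j. c j \<ge> 0"
  shows "\<exists>B\<ge>0. \<forall>y\<ge>0. (\<Sum>j\<in>{1..<m}. c j * y ^ j) \<le> \<eta> * y ^ m + B"
proof -
  define C where "C = (\<Sum>j\<in>{1..<m}. c j)"
  have C: "C \<ge> 0" unfolding C_def by (intro sum_nonneg c)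
  define Y where "Y = max 1 (C / \<eta>)"
  have Y: "Y \<ge> 1" "C \<le> \<eta> * Y"
    using \<open>\<eta> > 0\<close> by (auto simp: Y_def max_def field_simps)
  have "(\<Sum>j\<in>{1..<m}. c j * y ^ j) \<le> \<eta> * y ^ m + C * Y ^ m" if y: "y \<ge> 0" for y
  proof (cases "y \<le> Y")
    case True
    have "(\<Sum>j\<in>{1..<m}. c j * y ^ j) \<le> (\<Sum>j\<in>{1..<m}. c j * Y ^ m)"
    proof (intro sum_mono mult_left_mono c)
      fix j assume "j \<in> {1..<m}"
      then show "y ^ j \<le> Y ^ m"
        using power_mono[OF True y, of j] power_increasing[of j m Y] Y by auto
    qed
    also have "\<dots> = C * Y ^ m" by (simp add: C_def sum_distrib_right)
    finally show ?thesis using y \<open>\<eta> > 0\<close> by (simp add: add_increasing)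
  next
    case False
    then have y1: "y \<ge> 1" "Y \<le> y" using Y by auto
    have "(\<Sum>j\<in>{1..<m}. c j * y ^ j) \<le> (\<Sum>j\<in>{1..<m}. c j * y ^ (m - 1))"
      by (intro sum_mono mult_left_mono c power_increasing y1) auto
    also have "\<dots> = C * y ^ (m - 1)" by (simp add: C_def sum_distrib_right)
    also have "\<dots> \<le> \<eta> * y ^ m"
    proof (cases m)
      case (Suc k)
      have "C \<le> \<eta> * y"
        using Y(2) y1(2) \<open>\<eta> > 0\<close> by (meson mult_left_mono less_imp_le order_trans)
      then have "C * y ^ k \<le> \<eta> * y * y ^ k" using y by (intro mult_right_mono) auto
      then show ?thesis using Suc by (simp add: mult.assoc)
    qed (use \<open>\<eta> > 0\<close> in \<open>simp add: C_def\<close>)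
    finally show ?thesis using C Y by (simp add: add_increasing2)
  qed
  then show ?thesis using C Y by (intro exI[of _ "C * Y ^ m"]) auto
qed

lemma norm_exp_delay:
  "norm (exp (- (of_nat j * s * of_real h))) = exp (- (h * Re s)) ^ j"
  by (simp add: norm_exp_eq_Re exp_of_nat_mult[symmetric] algebra_simps)

lemma char_fun_has_field_derivative [derivative_intros]:
  "(char_fun N h a ad has_field_derivative coeff_denom N h ad s) (at s)"
  unfolding char_fun_def[abs_def] coeff_denom_def
  by (rule derivative_eq_intros refl | simp)+
    (simp add: sum_negf[symmetric] mult_ac)

lemma char_fun_holomorphic: "char_fun N h a ad holomorphic_on A"
  using char_fun_has_field_derivative
  by (metis DERIV_subset field_differentiable_def holomorphic_on_def subset_UNIV)

lemma exp_dominates_linear: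
  fixes k c C :: real
  assumes "k > 0" "c > 0" "C \<ge> 0"
  shows "\<exists>r0. \<forall>r\<ge>r0. C + 2 * r \<le> c * exp (k * r)"
proof -
  define d where "d = c * k\<^sup>2 / 2"
  have d: "d > 0" using assms by (simp add: d_def)
  have "C + 2 * r \<le> c * exp (k * r)" if "r \<ge> max 1 ((C + 2) / d)" for r
  proof -
    have r: "r \<ge> 1" "C + 2 \<le> d * r" using that d by (auto simp: field_simps)
    have "C + 2 * r \<le> (C + 2) * r" using r mult_left_mono[of 1 r C] assms by (simp add: algebra_simps)
    also have "\<dots> \<le> d * r * r" using r by (intro mult_right_mono) auto
    also have "\<dots> = c * ((k * r)\<^sup>2 / 2)" by (simp add: d_def power2_eq_square)
    also have "\<dots> \<le> c * exp (k * r)"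
    proof (rule mult_left_mono)
      have "k * r \<ge> 0" using assms r by simp
      then show "(k * r)\<^sup>2 / 2 \<le> exp (k * r)"
        using exp_lower_Taylor_quadratic[of "k * r"] by linarith
    qed (use assms in simp)
    finally show ?thesis .
  qed
  then show ?thesis by blast
qed

lemma cos_ge_half:
  assumes "\<bar>x\<bar> \<le> pi / 3"
  shows "cos x \<ge> 1 / 2"
proof -
  have "cos (pi / 3) \<le> cos \<bar>x\<bar>" by (rule cos_monotone_0_pi_le) (use assms in auto)
  then show ?thesis by (simp add: cos_60)
qed

text \<open>
  The largest index \<open>m\<close> with a nonzero coefficient governs \<open>\<Delta>\<close> far to the left.
\<close>

locale delay_system =
  fixes N :: nat and h a :: real and ad :: "nat \<Rightarrow> real" and m :: nat
  assumes h_pos: "h > 0"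
    and m_range: "1 \<le> m" "m \<le> N"
    and lead_nonzero: "ad m \<noteq> 0"
    and above_lead: "\<And>j. m < j \<Longrightarrow> j \<le> N \<Longrightarrow> ad j = 0"
begin

abbreviation "\<Delta> \<equiv> char_fun N h a ad"
abbreviation "\<Delta>' \<equiv> coeff_denom N h ad"

definition lead_size :: "complex \<Rightarrow> real" where
  "lead_size s = exp (- (real m * h * Re s))"

lemma mh_pos: "real m * h > 0" using h_pos m_range by simp

lemma lead_size_pos: "lead_size s > 0" by (simp add: lead_size_def)

lemma lead_size_eq: "lead_size s = exp (- (h * Re s)) ^ m"
  using exp_of_nat_mult[of m "- (h * Re s)"] unfolding lead_size_def by (simp only: mult_minus_right mult.assoc)

lemma norm_lead_term: "norm (exp (- (of_nat m * s * of_real h))) = lead_size s"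
  by (simp add: norm_exp_delay lead_size_eq del: norm_exp_eq_Re)

lemma sum_split_lead:
  fixes F :: "nat \<Rightarrow> 'b::comm_monoid_add"
  assumes "\<And>j. m < j \<Longrightarrow> j \<le> N \<Longrightarrow> F j = 0"
  shows "(\<Sum>j=1..N. F j) = F m + (\<Sum>j\<in>{1..<m}. F j)"
proof -
  have "(\<Sum>j=1..N. F j) = (\<Sum>j\<in>insert m {1..<m}. F j)"
    by (rule sum.mono_neutral_right) (use m_range assms linorder_neqE_nat in \<open>auto, blast\<close>)
  then show ?thesis by simp
qed

lemma char_fun_approx:
  assumes "\<eta> > 0"
  shows "\<exists>B\<ge>0. \<forall>s. norm (\<Delta> s - (s - of_real a - of_real (ad m) * exp (- (of_nat m * s * of_real h))))
      \<le> \<eta> * lead_size s + B"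
proof -
  obtain B where B: "B \<ge> 0" "\<And>y. y \<ge> 0 \<Longrightarrow> (\<Sum>j\<in>{1..<m}. \<bar>ad j\<bar> * y ^ j) \<le> \<eta> * y ^ m + B"
    using lower_powers_bound[OF assms, of "\<lambda>j. \<bar>ad j\<bar>" m] by auto
  have "norm (\<Delta> s - (s - of_real a - of_real (ad m) * exp (- (of_nat m * s * of_real h))))
      \<le> \<eta> * lead_size s + B" for s
  proof -
    have "\<Delta> s - (s - of_real a - of_real (ad m) * exp (- (of_nat m * s * of_real h)))
        = - (\<Sum>j\<in>{1..<m}. of_real (ad j) * exp (- (of_nat j * s * of_real h)))"
      unfolding char_fun_def by (subst sum_split_lead) (auto simp: above_lead)
    also have "norm \<dots> \<le> (\<Sum>j\<in>{1..<m}. \<bar>ad j\<bar> * exp (- (h * Re s)) ^ j)"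
      unfolding norm_minus_cancel
      by (rule order_trans[OF norm_sum]) (simp add: norm_mult norm_exp_delay del: norm_exp_eq_Re)
    also have "\<dots> \<le> \<eta> * lead_size s + B"
      unfolding lead_size_eq by (rule B) simp
    finally show ?thesis .
  qed
  then show ?thesis using B(1) by blast
qed

lemma coeff_denom_approx:
  assumes "\<eta> > 0"
  shows "\<exists>B\<ge>0. \<forall>s. norm (\<Delta>' s - of_real (real m * h * ad m) * exp (- (of_nat m * s * of_real h)))
      \<le> \<eta> * lead_size s + B"
proof -
  obtain B where B: "B \<ge> 0"
      "\<And>y. y \<ge> 0 \<Longrightarrow> (\<Sum>j\<in>{1..<m}. (real j * \<bar>ad j\<bar> * h) * y ^ j) \<le> \<eta> * y ^ m + B"
    using lower_powers_bound[OF assms, of "\<lambda>j. real j * \<bar>ad j\<bar> * h" m] h_pos by auto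
  have "norm (\<Delta>' s - of_real (real m * h * ad m) * exp (- (of_nat m * s * of_real h)))
      \<le> \<eta> * lead_size s + (B + 1)" for s
  proof -
    have "\<Delta>' s - of_real (real m * h * ad m) * exp (- (of_nat m * s * of_real h))
        = 1 + (\<Sum>j\<in>{1..<m}. of_nat j * of_real (ad j) * of_real h * exp (- (of_nat j * s * of_real h)))"
      unfolding coeff_denom_def by (subst sum_split_lead) (auto simp: above_lead)
    also have "norm \<dots> \<le> 1 + (\<Sum>j\<in>{1..<m}. (real j * \<bar>ad j\<bar> * h) * exp (- (h * Re s)) ^ j)"
      by (rule order_trans[OF norm_triangle_ineq], rule add_mono, simp,
          rule order_trans[OF norm_sum]) (use h_pos in \<open>simp add: norm_mult norm_exp_delay del: norm_exp_eq_Re\<close>)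
    also have "\<dots> \<le> \<eta> * lead_size s + (B + 1)"
      using B(2)[of "exp (- (h * Re s))"] by (simp add: lead_size_eq)
    finally show ?thesis .
  qed
  then show ?thesis using B(1) by (intro exI[of _ "B+1"]) auto
qed

text \<open>
  At such a height \<open>R\<close> the terms \<open>s\<close> and \<open>- ad m * exp (- m h s)\<close> have imaginary parts of the
  same sign, for every real part of \<open>s\<close>. So they cannot cancel, and only the lower exponential
  terms remain to be absorbed.
\<close>

lemma char_fun_on_level:
  "\<exists>R0. \<forall>R s. R \<ge> R0 \<longrightarrow> ad m * sin (real m * h * R) = \<bar>ad m\<bar> \<longrightarrow> \<bar>Im s\<bar> = R
      \<longrightarrow> (R + \<bar>ad m\<bar> * lead_size s) / 2 \<le> norm (\<Delta> s)"
proof -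
  obtain B where B: "B \<ge> 0" "\<And>s. norm (\<Delta> s - (s - of_real a - of_real (ad m) *
      exp (- (of_nat m * s * of_real h)))) \<le> \<bar>ad m\<bar> / 2 * lead_size s + B"
    using char_fun_approx[of "\<bar>ad m\<bar> / 2"] lead_nonzero by auto
  have "(R + \<bar>ad m\<bar> * lead_size s) / 2 \<le> norm (\<Delta> s)"
    if R: "R \<ge> 2 * B" "ad m * sin (real m * h * R) = \<bar>ad m\<bar>" "\<bar>Im s\<bar> = R" for R s
  proof -
    define z where "z = s - of_real a - of_real (ad m) * exp (- (of_nat m * s * of_real h))"
    have im: "Im z = Im s + ad m * sin (real m * h * Im s) * lead_size s"
      by (simp add: z_def Im_exp lead_size_def mult_ac)
    have "\<bar>Im z\<bar> = R + \<bar>ad m\<bar> * lead_size s"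
    proof (cases "Im s \<ge> 0")
      case True
      then have "Im s = R" using R(3) by simp
      then show ?thesis unfolding im using R B(1) lead_size_pos[of s] by (simp add: abs_mult)
    next
      case False
      then have eq: "Im s = - R" using R(3) by simp
      have "Im z = - (R + \<bar>ad m\<bar> * lead_size s)"
        unfolding im eq using R(2) by simp
      moreover have "0 \<le> R + \<bar>ad m\<bar> * lead_size s"
        using R(3) less_imp_le[OF lead_size_pos[of s]] by (metis abs_ge_zero add_nonneg_nonneg mult_nonneg_nonneg)
      ultimately show ?thesis by simp
    qed
    then have "R + \<bar>ad m\<bar> * lead_size s \<le> norm z" using abs_Im_le_cmod[of z] by simp
    moreover have "norm z \<le> norm (\<Delta> s) + norm (\<Delta> s - z)"
      using norm_triangle_ineq4[of "\<Delta> s" "\<Delta> s - z"] by simp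
    moreover have "norm (\<Delta> s - z) \<le> \<bar>ad m\<bar> / 2 * lead_size s + B"
      unfolding z_def by (rule B)
    ultimately show ?thesis using R(1) by (simp add: field_simps)
  qed
  then show ?thesis by blast
qed

lemma char_fun_far_left:
  "\<exists>R0. \<forall>s. Re s \<le> - R0 \<longrightarrow> \<bar>Im s\<bar> \<le> - Re s \<longrightarrow> \<bar>ad m\<bar> / 4 * lead_size s \<le> norm (\<Delta> s)"
proof -
  obtain B where B: "B \<ge> 0" "\<And>s. norm (\<Delta> s - (s - of_real a - of_real (ad m) *
      exp (- (of_nat m * s * of_real h)))) \<le> \<bar>ad m\<bar> / 2 * lead_size s + B"
    using char_fun_approx[of "\<bar>ad m\<bar> / 2"] lead_nonzero by auto
  obtain r0 where r0: "\<And>r. r \<ge> r0 \<Longrightarrow> (B + \<bar>a\<bar>) + 2 * r \<le> \<bar>ad m\<bar> / 4 * exp (real m * h * r)"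
    using exp_dominates_linear[of "real m * h" "\<bar>ad m\<bar> / 4" "B + \<bar>a\<bar>"] mh_pos lead_nonzero B
    by auto
  have "\<bar>ad m\<bar> / 4 * lead_size s \<le> norm (\<Delta> s)" if "Re s \<le> - r0" "\<bar>Im s\<bar> \<le> - Re s" for s
  proof -
    define z where "z = of_real (ad m) * exp (- (of_nat m * s * of_real h))"
    have nz: "norm z = \<bar>ad m\<bar> * lead_size s"
      by (simp add: z_def norm_mult norm_lead_term del: norm_exp_eq_Re)
    define E where "E = \<Delta> s - (s - of_real a - z)"
    have E: "norm E \<le> \<bar>ad m\<bar> / 2 * lead_size s + B" unfolding E_def z_def by (rule B)
    have "z = E + s - of_real a - \<Delta> s" by (simp add: E_def)
    then have "norm z \<le> norm E + norm s + \<bar>a\<bar> + norm (\<Delta> s)"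
      by (metis add_mono norm_of_real norm_triangle_ineq norm_triangle_le_diff order_refl)
    moreover have "norm s \<le> 2 * (- Re s)" using cmod_le[of s] that(2) by linarith
    moreover have "B + \<bar>a\<bar> + 2 * (- Re s) \<le> \<bar>ad m\<bar> / 4 * lead_size s"
      using r0[of "- Re s"] that by (simp add: lead_size_def)
    ultimately show ?thesis using nz E by linarith
  qed
  then show ?thesis by blast
qed

lemma delay_sum_bound:
  "norm (\<Sum>j=1..N. of_real (ad j) * exp (- (of_nat j * s * of_real h)))
    \<le> (\<Sum>j=1..N. \<bar>ad j\<bar>) * exp (- (h * Re s))" if "Re s \<ge> 0"
proof -
  have "norm (\<Sum>j=1..N. of_real (ad j) * exp (- (of_nat j * s * of_real h)))
      \<le> (\<Sum>j=1..N. \<bar>ad j\<bar> * exp (- (h * Re s)) ^ j)"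
    by (rule order_trans[OF norm_sum]) (simp add: norm_mult norm_exp_delay del: norm_exp_eq_Re)
  also have "\<dots> \<le> (\<Sum>j=1..N. \<bar>ad j\<bar> * exp (- (h * Re s)) ^ 1)"
    by (intro sum_mono mult_left_mono power_decreasing) (use that h_pos in auto)
  finally show ?thesis by (simp add: sum_distrib_right)
qed

lemma char_fun_right:
  assumes "Re s \<ge> 0" "norm s \<ge> 2 * (\<bar>a\<bar> + (\<Sum>j=1..N. \<bar>ad j\<bar>))"
  shows "norm s / 2 \<le> norm (\<Delta> s)"
proof -
  define Q where "Q = (\<Sum>j=1..N. of_real (ad j) * exp (- (of_nat j * s * of_real h)))"
  have "norm Q \<le> (\<Sum>j=1..N. \<bar>ad j\<bar>) * exp (- (h * Re s))"
    unfolding Q_def by (rule delay_sum_bound[OF assms(1)])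
  also have "\<dots> \<le> (\<Sum>j=1..N. \<bar>ad j\<bar>) * 1"
    by (intro mult_left_mono sum_nonneg) (use assms h_pos in auto)
  finally have "norm Q \<le> (\<Sum>j=1..N. \<bar>ad j\<bar>)" by simp
  moreover have "s = \<Delta> s + of_real a + Q" by (simp add: char_fun_def Q_def)
  then have "norm s \<le> norm (\<Delta> s) + \<bar>a\<bar> + norm Q"
    by (metis add_mono norm_of_real norm_triangle_ineq norm_triangle_le order_refl)
  ultimately show ?thesis using assms(2) by simp
qed

lemma high_roots_left:
  "\<exists>K. \<forall>s. \<Delta> s = 0 \<longrightarrow> K \<le> \<bar>Im s\<bar> \<longrightarrow> Re s \<le> - c"
proof -
  define K where "K = \<bar>a\<bar> + (\<Sum>j=1..N. \<bar>ad j\<bar> * exp (h * c) ^ j) + 1"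
  have "Re s \<le> - c" if "\<Delta> s = 0" "K \<le> \<bar>Im s\<bar>" for s
  proof (rule ccontr)
    assume "\<not> Re s \<le> - c"
    then have e: "exp (- (h * Re s)) \<le> exp (h * c)"
      using mult_left_mono[of "-c" "Re s" h] h_pos by simp
    have "s = of_real a + (\<Sum>j=1..N. of_real (ad j) * exp (- (of_nat j * s * of_real h)))"
      using that(1) by (simp add: char_fun_def algebra_simps)
    then have "norm s \<le> \<bar>a\<bar> + norm (\<Sum>j=1..N. of_real (ad j) * exp (- (of_nat j * s * of_real h)))"
      by (metis norm_of_real norm_triangle_ineq)
    also have "\<dots> \<le> \<bar>a\<bar> + (\<Sum>j=1..N. \<bar>ad j\<bar> * exp (- (h * Re s)) ^ j)"
      by (rule add_left_mono, rule order_trans[OF norm_sum]) (simp add: norm_mult norm_exp_delay del: norm_exp_eq_Re)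
    also have "\<dots> \<le> \<bar>a\<bar> + (\<Sum>j=1..N. \<bar>ad j\<bar> * exp (h * c) ^ j)"
      by (intro add_left_mono sum_mono mult_left_mono power_mono e) auto
    finally show False using that(2) abs_Im_le_cmod[of s] by (simp add: K_def)
  qed
  then show ?thesis by blast
qed

lemma lead_size_large: "\<exists>c. \<forall>s. Re s \<le> - c \<longrightarrow> B \<le> lead_size s"
proof -
  have "B \<le> lead_size s" if "Re s \<le> - (\<bar>B\<bar> / (real m * h))" for s
  proof -
    have "\<bar>B\<bar> \<le> - Re s * (real m * h)"
      using that mh_pos by (metis le_minus_iff pos_divide_le_eq)
    then show ?thesis
      using exp_ge_add_one_self[of "- (real m * h * Re s)"] by (simp add: lead_size_def mult_ac)
  qed
  then show ?thesis by blast
qed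

lemma coeff_denom_far_left:
  "\<exists>c. \<forall>s. Re s \<le> - c \<longrightarrow> real m * h * \<bar>ad m\<bar> / 2 * lead_size s \<le> norm (\<Delta>' s)"
proof -
  define k where "k = real m * h * \<bar>ad m\<bar>"
  have k: "k > 0" unfolding k_def using mh_pos lead_nonzero by simp
  obtain B where B: "\<And>s. norm (\<Delta>' s - of_real (real m * h * ad m) * exp (- (of_nat m * s * of_real h)))
      \<le> k / 4 * lead_size s + B"
    using coeff_denom_approx[of "k / 4"] k by auto
  obtain c where c: "\<And>s. Re s \<le> - c \<Longrightarrow> 4 * B / k \<le> lead_size s"
    using lead_size_large by blast
  have "k / 2 * lead_size s \<le> norm (\<Delta>' s)" if "Re s \<le> - c" for s
  proof -
    define z where "z = of_real (real m * h * ad m) * exp (- (of_nat m * s * of_real h))"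
    have "norm z = k * lead_size s"
      unfolding z_def k_def norm_mult norm_lead_term
      using h_pos by (simp add: norm_mult)
    moreover have "norm z \<le> norm (\<Delta>' s) + norm (\<Delta>' s - z)"
      using norm_triangle_ineq4[of "\<Delta>' s" "\<Delta>' s - z"] by simp
    moreover have "norm (\<Delta>' s - z) \<le> k / 4 * lead_size s + B" unfolding z_def by (rule B)
    moreover have "B \<le> k / 4 * lead_size s" using c[OF that] k by (simp add: field_simps)
    ultimately show ?thesis by linarith
  qed
  then show ?thesis unfolding k_def by blast
qed

text \<open>
  In the far left half plane \<open>\<Delta>'\<close> is close to \<open>m h ad m exp (- m h s)\<close>, whose argument varies
  by at most \<open>pi / 3\<close> around its value at height \<open>y\<close> in the strip. After a rotation the real
  part of \<open>\<Delta>'\<close> is positive on this convex set, and a function with that property is injective: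
  \<open>\<Delta> (s + \<theta> w) / w\<close>, so rotated, has an increasing real part along any segment.
\<close>

lemma char_fun_inj_on_strip:
  "\<exists>c. \<forall>y. inj_on \<Delta> {s. Re s \<le> - c \<and> \<bar>Im s - y\<bar> \<le> pi / (3 * real m * h)}"
proof -
  define k where "k = real m * h * \<bar>ad m\<bar>"
  have k: "k > 0" unfolding k_def using mh_pos lead_nonzero by simp
  obtain B where B: "\<And>s. norm (\<Delta>' s - of_real (real m * h * ad m) * exp (- (of_nat m * s * of_real h)))
      \<le> k / 4 * lead_size s + B"
    using coeff_denom_approx[of "k / 4"] k by auto
  obtain c where c: "\<And>s. Re s \<le> - c \<Longrightarrow> 4 * (\<bar>B\<bar> + 1) / k \<le> lead_size s"
    using lead_size_large by blast
  have "inj_on \<Delta> {s. Re s \<le> - c \<and> \<bar>Im s - y\<bar> \<le> pi / (3 * real m * h)}" (is "inj_on \<Delta> ?S") for y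
  proof (rule inj_onI, rule ccontr)
    fix s s' assume s: "s \<in> ?S" "s' \<in> ?S" "\<Delta> s = \<Delta> s'" "s \<noteq> s'"
    define \<delta> where "\<delta> = pi / (3 * real m * h)"
    define w where "w = s' - s"
    have w: "w \<noteq> 0" using s by (simp add: w_def)
    have pos: "0 < Re (of_real (sgn (ad m)) * cis (real m * h * y) * \<Delta>' p)" if p: "p \<in> ?S" for p
    proof -
      define u where "u = of_real (sgn (ad m)) * cis (real m * h * y)"
      define z where "z = of_real (real m * h * ad m) * exp (- (of_nat m * p * of_real h))"
      have u: "norm u = 1" using lead_nonzero by (simp add: u_def norm_mult sgn_if)
      have ex: "exp (- (of_nat m * p * of_real h)) = of_real (lead_size p) * cis (- (real m * h * Im p))"
        by (simp add: exp_eq_polar lead_size_def mult_ac)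
      have "u * z = of_real (sgn (ad m) * (real m * h * ad m) * lead_size p)
          * (cis (real m * h * y) * cis (- (real m * h * Im p)))"
        by (simp add: u_def z_def ex)
      also have "sgn (ad m) * (real m * h * ad m) = k" by (simp add: k_def sgn_if)
      finally have "u * z = of_real (k * lead_size p) * cis (real m * h * y - real m * h * Im p)"
        by (simp add: cis_mult)
      then have "Re (u * z) = k * lead_size p * cos (real m * h * y - real m * h * Im p)"
        by simp
      moreover have "cos (real m * h * y - real m * h * Im p) \<ge> 1/2"
      proof (rule cos_ge_half)
        have "\<bar>real m * h * y - real m * h * Im p\<bar> = real m * h * \<bar>Im p - y\<bar>"
          using h_pos by (simp add: abs_mult abs_minus_commute flip: right_diff_distrib)
        also have "\<dots> \<le> real m * h * (pi / (3 * real m * h))"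
          using p mh_pos by (intro mult_left_mono) auto
        finally show "\<bar>real m * h * y - real m * h * Im p\<bar> \<le> pi / 3"
          using h_pos m_range by simp
      qed
      ultimately have main: "Re (u * z) \<ge> k * lead_size p * (1/2)"
        using k lead_size_pos[of p] by (metis less_imp_le mult_left_mono mult_pos_pos)
      have "Re (u * (\<Delta>' p - z)) \<ge> - norm (u * (\<Delta>' p - z))"
        using abs_Re_le_cmod[of "u * (\<Delta>' p - z)"] by linarith
      moreover have "norm (u * (\<Delta>' p - z)) \<le> k / 4 * lead_size p + B"
        unfolding norm_mult u using B[of p] by (simp add: z_def)
      moreover have "B < k / 4 * lead_size p"
      proof -
        have "4 * (\<bar>B\<bar> + 1) \<le> lead_size p * k" using c[of p] p k by (simp add: pos_divide_le_eq)
        then show ?thesis by (simp add: mult.commute)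
      qed
      moreover have "Re (u * \<Delta>' p) = Re (u * z) + Re (u * (\<Delta>' p - z))"
        by (simp add: algebra_simps)
      ultimately have "0 < Re (u * \<Delta>' p)" using main by linarith
      then show ?thesis by (simp add: u_def)
    qed
    define u where "u = of_real (sgn (ad m)) * cis (real m * h * y)"
    define g where "g \<theta> = Re (u * \<Delta> (s + of_real \<theta> * w) / w)" for \<theta> :: real
    have deriv: "(g has_real_derivative Re (u * \<Delta>' (s + of_real \<theta> * w))) (at \<theta>)" for \<theta>
    proof -
      have "((\<lambda>\<theta>. \<Delta> (s + of_real \<theta> * w)) has_vector_derivative w * \<Delta>' (s + of_real \<theta> * w)) (at \<theta>)"
      proof -
        have "((\<lambda>\<theta>. s + of_real \<theta> * w) has_vector_derivative 0 + of_real 1 * w) (at \<theta>)"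
          by (intro has_vector_derivative_add has_vector_derivative_const
              has_vector_derivative_mult_left has_vector_derivative_of_real DERIV_ident)
        from field_vector_diff_chain_at[OF this char_fun_has_field_derivative]
        show ?thesis unfolding o_def by simp
      qed
      then have "((\<lambda>\<theta>. u / w * \<Delta> (s + of_real \<theta> * w)) has_vector_derivative
          u / w * (w * \<Delta>' (s + of_real \<theta> * w))) (at \<theta>)"
        by (rule has_vector_derivative_mult_right)
      then have "((\<lambda>\<theta>. u * \<Delta> (s + of_real \<theta> * w) / w) has_vector_derivative
          u * \<Delta>' (s + of_real \<theta> * w)) (at \<theta>)"
        using w by simp
      from bounded_linear.has_vector_derivative[OF bounded_linear_Re this]
      show ?thesis
        unfolding g_def[abs_def] has_real_derivative_iff_has_vector_derivative .
    qed
    have "g 0 < g 1"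
    proof (rule DERIV_pos_imp_increasing[of 0 1 g])
      fix \<theta> :: real assume \<theta>: "0 \<le> \<theta>" "\<theta> \<le> 1"
      have "convex ?S"
      proof -
        have "?S = {s. Re s \<le> - c} \<inter> ({s. Im s \<le> y + \<delta>} \<inter> {s. Im s \<ge> y - \<delta>})"
          unfolding \<delta>_def[symmetric] by (simp only: set_eq_iff mem_Collect_eq Int_iff abs_diff_le_iff) blast
        then show ?thesis
          by (simp only:) (intro convex_Int convex_halfspace_Re_le convex_halfspace_Im_le convex_halfspace_Im_ge)
      qed
      then have "(1 - \<theta>) *\<^sub>R s + \<theta> *\<^sub>R s' \<in> ?S" using s \<theta> by (intro convexD) auto
      moreover have "(1 - \<theta>) *\<^sub>R s + \<theta> *\<^sub>R s' = s + of_real \<theta> * w"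
        by (simp add: w_def scaleR_conv_of_real algebra_simps)
      ultimately have "0 < Re (u * \<Delta>' (s + of_real \<theta> * w))" using pos[of "s + of_real \<theta> * w"] unfolding u_def by (simp only:)
      then show "\<exists>d. (g has_real_derivative d) (at \<theta>) \<and> 0 < d" using deriv by blast
    qed simp
    then show False using s(3) by (simp add: g_def w_def)
  qed
  then show ?thesis by blast
qed

section \<open>Residue sums over squares\<close>

definition square_sum :: "real \<Rightarrow> real \<Rightarrow> complex" where
  "square_sum R t = (\<Sum>p | \<Delta> p = 0 \<and> p \<in> box (Complex (-R) (-R)) (Complex R R). exp (p * of_real t) / \<Delta>' p)"

text \<open>
  The values of \<open>\<Psi>\<close> up to time \<open>h\<close>, except at its jump: \<open>\<Psi> 0 = 1\<close>.
\<close>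

definition step_exp :: "real \<Rightarrow> complex" where
  "step_exp t = (if t > 0 then exp (of_real (a * t)) else 0)"

text \<open>
  The integrand is \<open>exp (s * t) * F s\<close>, where \<open>F\<close> is \<open>1 / \<Delta>\<close> for \<open>t \<le> 0\<close> and
  \<open>1 / \<Delta> - 1 / (s - a)\<close> for \<open>t > 0\<close>. Each side of the square contributes a part that vanishes
  uniformly in \<open>t\<close> as \<open>R\<close> grows, and a part governed by \<open>exp (- \<bar>t\<bar> * \<bar>Re s\<bar>) / R\<close>. The
  integral of the latter is bounded for all \<open>t\<close> and at most of order \<open>1 / (R * \<bar>t\<bar>)\<close>; this is
  the source of the two bounds, one for dominated convergence across the jump at \<open>0\<close> and one
  for convergence away from it.
\<close>

lemma square_sum_error:
  assumes simple: "\<And>s. \<Delta> s = 0 \<Longrightarrow> \<Delta>' s \<noteq> 0"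
    and \<epsilon>: "0 < \<epsilon>" "\<epsilon> \<le> real m * h"
  shows "\<exists>\<rho> R0. (\<rho> \<longlongrightarrow> 0) at_top \<and>
    (\<forall>R\<ge>R0. ad m * sin (real m * h * R) = \<bar>ad m\<bar> \<longrightarrow> (\<forall>t\<in>{\<epsilon> - real m * h..h}.
      norm (square_sum R t - step_exp t) \<le> \<rho> R + 16 \<and>
      (t \<noteq> 0 \<longrightarrow> norm (square_sum R t - step_exp t) \<le> \<rho> R + 16 / (R * \<bar>t\<bar>))))"
proof -
  define \<alpha> where "\<alpha> = \<bar>ad m\<bar>"
  define k where "k = real m * h"
  define q where "q = \<epsilon> / (2 * k)"
  define A where "A = (\<Sum>j=1..N. \<bar>ad j\<bar>)"
  have pos: "\<alpha> > 0" "k > 0" "q > 0" "A \<ge> 0"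
    using lead_nonzero mh_pos \<epsilon> by (auto simp: \<alpha>_def k_def q_def A_def intro!: sum_nonneg divide_pos_pos)
  obtain R1 where R1: "\<And>R s. R \<ge> R1 \<Longrightarrow> ad m * sin (real m * h * R) = \<bar>ad m\<bar> \<Longrightarrow> \<bar>Im s\<bar> = R
      \<Longrightarrow> (R + \<alpha> * lead_size s) / 2 \<le> norm (\<Delta> s)"
    using char_fun_on_level unfolding \<alpha>_def by blast
  obtain R2 where R2: "\<And>s. Re s \<le> - R2 \<Longrightarrow> \<bar>Im s\<bar> \<le> - Re s \<Longrightarrow> \<alpha> / 4 * lead_size s \<le> norm (\<Delta> s)"
    using char_fun_far_left unfolding \<alpha>_def by blast
  define R0 where "R0 = Max {1, R1, R2, 2 * (\<bar>a\<bar> + A)}"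
  define \<rho> where "\<rho> R = 16 / (\<alpha> * \<epsilon>) * (\<alpha> / R) powr q + (16 * A + 16 / (\<alpha> * \<epsilon>\<^sup>2)) / R" for R
  have "(\<rho> \<longlongrightarrow> 16 / (\<alpha> * \<epsilon>) * 0 + 0) at_top"
    unfolding \<rho>_def
  proof (intro tendsto_intros)
    have inv: "((\<lambda>R. c / R) \<longlongrightarrow> 0) at_top" for c :: real
      by (rule tendsto_divide_0[OF tendsto_const filterlim_at_top_imp_at_infinity[OF filterlim_ident]])
    then show "((\<lambda>R. (16 * A + 16 / (\<alpha> * \<epsilon>\<^sup>2)) / R) \<longlongrightarrow> 0) at_top" .
    show "((\<lambda>R. (\<alpha> / R) powr q) \<longlongrightarrow> 0) at_top"
      by (rule tendsto_zero_powrI[OF inv tendsto_const])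
        (use pos in \<open>auto intro: eventually_mono[OF eventually_gt_at_top[of 0]]\<close>)
  qed
  then have \<rho>: "(\<rho> \<longlongrightarrow> 0) at_top" by simp
  have main: "norm (square_sum R t - step_exp t) \<le> \<rho> R + 16 \<and>
      (t \<noteq> 0 \<longrightarrow> norm (square_sum R t - step_exp t) \<le> \<rho> R + 16 / (R * \<bar>t\<bar>))"
    if R: "R \<ge> R0" and good: "ad m * sin (real m * h * R) = \<bar>ad m\<bar>" and t: "t \<in> {\<epsilon> - real m * h..h}" for R t
  proof -
    have Rs: "R \<ge> 1" "R \<ge> R1" "R \<ge> R2" "R \<ge> 2 * (\<bar>a\<bar> + A)" using R by (auto simp: R0_def)
    then have R0: "R > 0" and aR: "\<bar>a\<bar> \<le> R / 2" "\<bar>a\<bar> < R" using pos by auto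
    have t': "\<epsilon> - k \<le> t" "t \<le> h" using t by (auto simp: k_def)
    define Q where "Q s = (\<Sum>j=1..N. of_real (ad j) * exp (- (of_nat j * s * of_real h)))" for s :: complex
    define F where "F s = 1 / \<Delta> s - (if t > 0 then 1 / (s - of_real a) else 0)" for s
    define bd where "bd = cbox (Complex (-R) (-R)) (Complex R R) - box (Complex (-R) (-R)) (Complex R R)"
    have bd: "s \<in> bd \<longleftrightarrow> \<bar>Re s\<bar> \<le> R \<and> \<bar>Im s\<bar> \<le> R \<and> (\<bar>Im s\<bar> = R \<or> Re s = - R \<or> Re s = R)" for s
      by (auto simp: bd_def in_cbox_complex_iff in_box_complex_iff abs_if)
    have hor: "(R + \<alpha> * lead_size s) / 2 \<le> norm (\<Delta> s)" if "\<bar>Im s\<bar> = R" for s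
      by (rule R1[OF Rs(2) good that])
    have lft: "\<alpha> / 4 * lead_size s \<le> norm (\<Delta> s)" if "Re s = - R" "\<bar>Im s\<bar> \<le> R" for s
      by (rule R2) (use that Rs in auto)
    have rgt: "R / 2 \<le> norm (\<Delta> s)" if "Re s \<ge> 0" "R \<le> norm s" for s
    proof -
      have "norm s / 2 \<le> norm (\<Delta> s)"
        by (rule char_fun_right) (use that Rs in \<open>auto simp: A_def\<close>)
      then show ?thesis using that by simp
    qed
    have nz: "\<Delta> s \<noteq> 0" "s - of_real a \<noteq> 0" if "s \<in> bd" for s
    proof -
      from that consider "\<bar>Im s\<bar> = R" | "Re s = - R" "\<bar>Im s\<bar> \<le> R" | "Re s = R" "\<bar>Im s\<bar> \<le> R"
        by (auto simp: bd)
      then have "0 < norm (\<Delta> s)"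
      proof cases
        case 1
        moreover have "0 < (R + \<alpha> * lead_size s) / 2"
          using R0 pos lead_size_pos[of s] by (simp add: add_pos_pos)
        ultimately show ?thesis using hor[of s] by linarith
      next
        case 2
        moreover have "0 < \<alpha> / 4 * lead_size s" using pos lead_size_pos[of s] by simp
        ultimately show ?thesis using lft[of s] by linarith
      next
        case 3
        then have "R \<le> norm s" using abs_Re_le_cmod[of s] R0 by linarith
        then show ?thesis using rgt[of s] R0 3 by linarith
      qed
      then show "\<Delta> s \<noteq> 0" by auto
      show "s - of_real a \<noteq> 0"
        using that aR R0 by (auto simp: bd complex_eq_iff)
    qed
    \<comment> \<open>For \<open>t > 0\<close> the difference of reciprocals equals \<open>Q s / ((s - a) * \<Delta> s)\<close>.  The factor \<open>exp (- h * Re s)\<close> in the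
      bound of \<open>Q\<close> compensates the growth of \<open>exp (s * t)\<close> as long as \<open>t \<le> h\<close>.\<close>
    have F_right: "exp (Re s * t) * norm (F s) \<le> 2 / R * exp (- (\<bar>t\<bar> * \<bar>Re s\<bar>)) + 2 * A / (R * B)"
      if "Re s \<ge> 0" "R \<le> norm s" "B > 0" "B \<le> norm (s - of_real a)" "\<Delta> s \<noteq> 0" for s B
    proof (cases "t > 0")
      case False
      have "norm (F s) = 1 / norm (\<Delta> s)" using False by (simp add: F_def norm_divide)
      also have "\<dots> \<le> 1 / (R / 2)" using rgt[OF that(1,2)] R0 by (intro frac_le) auto
      finally have "exp (Re s * t) * norm (F s) \<le> exp (Re s * t) * (2 / R)"
        by (intro mult_left_mono) auto
      moreover have "exp (Re s * t) = exp (- (\<bar>t\<bar> * \<bar>Re s\<bar>))" using False that(1) by simp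
      moreover have "0 \<le> 2 * A / (R * B)" using pos R0 that by simp
      ultimately show ?thesis by (simp add: mult.commute)
    next
      case True
      have ne: "s - of_real a \<noteq> 0" using that by auto
      have "\<Delta> s = s - of_real a - Q s" by (simp add: char_fun_def Q_def)
      then have "F s = Q s / ((s - of_real a) * \<Delta> s)"
        using True ne that(5) by (simp add: F_def diff_frac_eq)
      then have "norm (F s) = norm (Q s) / (norm (s - of_real a) * norm (\<Delta> s))"
        by (simp add: norm_divide norm_mult)
      also have "\<dots> \<le> (A * exp (- (h * Re s))) / (B * (R / 2))"
        using delay_sum_bound[OF that(1)] rgt[OF that(1,2)] that R0 pos
        by (intro frac_le mult_mono mult_pos_pos) (auto simp: Q_def A_def)
      finally have "exp (Re s * t) * norm (F s) \<le> exp (Re s * t) * ((A * exp (- (h * Re s))) / (B * (R / 2)))"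
        by (intro mult_left_mono) auto
      also have "\<dots> = (exp (Re s * t) * exp (- (h * Re s))) * (2 * A / (R * B))"
        by (simp add: mult_ac)
      also have "exp (Re s * t) * exp (- (h * Re s)) = exp (Re s * (t - h))"
        by (simp add: algebra_simps flip: exp_add)
      also have "exp (Re s * (t - h)) * (2 * A / (R * B)) \<le> 1 * (2 * A / (R * B))"
        using that t' pos R0 by (intro mult_right_mono) (auto simp: mult_nonneg_nonpos)
      also have "\<dots> \<le> 2 / R * exp (- (\<bar>t\<bar> * \<bar>Re s\<bar>)) + 2 * A / (R * B)" using R0 by simp
      finally show ?thesis .
    qed
    have F_left: "exp (Re s * t) * norm (F s) \<le> exp (Re s * t) / norm (\<Delta> s) + 1 / B * exp (- (\<bar>t\<bar> * \<bar>Re s\<bar>))"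
      if "Re s \<le> 0" "B > 0" "B \<le> norm (s - of_real a)" for s B
    proof (cases "t > 0")
      case False
      then show ?thesis using that by (simp add: F_def norm_divide)
    next
      case True
      have "norm (F s) \<le> 1 / norm (\<Delta> s) + 1 / norm (s - of_real a)"
        using True norm_triangle_ineq4[of "1 / \<Delta> s" "1 / (s - of_real a)"] by (simp add: F_def norm_divide)
      also have "1 / norm (s - of_real a) \<le> 1 / B" using that by (intro frac_le) auto
      finally have "exp (Re s * t) * norm (F s) \<le> exp (Re s * t) * (1 / norm (\<Delta> s) + 1 / B)"
        by (intro mult_left_mono) auto
      moreover have "exp (Re s * t) = exp (- (\<bar>t\<bar> * \<bar>Re s\<bar>))" using True that by simp
      ultimately show ?thesis by (simp add: algebra_simps)
    qed
    define w where "w = 2 * (1 / \<alpha> * (\<alpha> / R) powr q)"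
    have w: "w \<ge> 0" using pos by (simp add: w_def)
    define g where "g x = w * exp (- (\<epsilon> / 2 * \<bar>x\<bar>)) + 2 / R * exp (- (\<bar>t\<bar> * \<bar>x\<bar>)) + 2 * A / R\<^sup>2" for x
    have horizontal: "norm (exp (s * of_real t) * F s) \<le> g (Re s)" if s: "\<bar>Im s\<bar> = R" "\<bar>Re s\<bar> \<le> R" for s
    proof -
      have Rn: "R \<le> norm s" "R \<le> norm (s - of_real a)"
        using s(1) abs_Im_le_cmod[of s] abs_Im_le_cmod[of "s - of_real a"] by auto
      have "exp (Re s * t) * norm (F s) \<le> g (Re s)"
      proof (cases "Re s \<ge> 0")
        case True
        have "\<Delta> s \<noteq> 0" using nz s by (auto simp: bd)
        from F_right[OF True Rn(1) R0 Rn(2) this]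
        have "exp (Re s * t) * norm (F s) \<le> 2 / R * exp (- (\<bar>t\<bar> * \<bar>Re s\<bar>)) + 2 * A / R\<^sup>2"
          unfolding power2_eq_square .
        moreover have "0 \<le> w * exp (- (\<epsilon> / 2 * \<bar>Re s\<bar>))" using w by simp
        ultimately show ?thesis unfolding g_def by linarith
      next
        case False
        have "exp (Re s * t) / norm (\<Delta> s) \<le> exp (Re s * t) / ((R + \<alpha> * lead_size s) / 2)"
          using hor[OF s(1)] R0 pos lead_size_pos[of s]
          by (intro frac_le) (auto intro!: add_pos_pos)
        also have "\<dots> = 2 * (exp (Re s * t) / (R + \<alpha> * exp (- (k * Re s))))"
          by (simp add: lead_size_def k_def)
        also have "\<dots> \<le> 2 * ((1 / \<alpha>) * (\<alpha> / R) powr (\<epsilon> / (2 * k)) * exp (- (\<epsilon> / 2 * \<bar>Re s\<bar>)))"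
          by (intro mult_left_mono exp_over_sum_bound) (use R0 pos \<epsilon> False t' in \<open>auto simp: k_def\<close>)
        also have "\<dots> = w * exp (- (\<epsilon> / 2 * \<bar>Re s\<bar>))" by (simp add: w_def q_def)
        finally have "exp (Re s * t) / norm (\<Delta> s) \<le> w * exp (- (\<epsilon> / 2 * \<bar>Re s\<bar>))" .
        moreover have "1 / R * exp (- (\<bar>t\<bar> * \<bar>Re s\<bar>)) \<le> 2 / R * exp (- (\<bar>t\<bar> * \<bar>Re s\<bar>))"
          using R0 by (intro mult_right_mono divide_right_mono) auto
        moreover have "0 \<le> 2 * A / R\<^sup>2" using pos by simp
        ultimately show ?thesis using F_left[OF _ R0 Rn(2)] False unfolding g_def by linarith
      qed
      then show ?thesis by (simp add: norm_mult norm_exp_eq_Re)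
    qed
    have left: "norm (exp (s * of_real t) * F s) \<le> 8 / (\<alpha> * \<epsilon>\<^sup>2 * R\<^sup>2) + 2 / R * exp (- (\<bar>t\<bar> * R))"
      if s: "Re s = - R" "\<bar>Im s\<bar> \<le> R" for s
    proof -
      have "R - \<bar>a\<bar> \<le> \<bar>Re (s - of_real a)\<bar>" using s by auto
      then have half: "R / 2 \<le> norm (s - of_real a)"
        using abs_Re_le_cmod[of "s - of_real a"] aR by linarith
      have "exp (Re s * t) / norm (\<Delta> s) \<le> exp (Re s * t) / (\<alpha> / 4 * lead_size s)"
        using lft[OF s] pos lead_size_pos[of s] by (intro frac_le) auto
      also have "\<dots> = 4 / \<alpha> * exp (- (R * (t + k)))"
      proof -
        have "exp (Re s * t) = exp (- (R * (t + k))) * lead_size s"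
          using s by (simp add: lead_size_def k_def algebra_simps flip: exp_add)
        then show ?thesis using lead_size_pos[of s] by simp
      qed
      also have "\<dots> \<le> 4 / \<alpha> * (2 / (\<epsilon> * R)\<^sup>2)"
      proof (rule mult_left_mono)
        have "exp (- (R * (t + k))) \<le> exp (- (\<epsilon> * R))"
          using mult_left_mono[of \<epsilon> "t + k" R] t' R0 by (simp add: mult.commute)
        also have "\<dots> \<le> 1 / ((\<epsilon> * R)\<^sup>2 / 2)"
        proof -
          have "(\<epsilon> * R)\<^sup>2 / 2 \<le> exp (\<epsilon> * R)"
            using exp_lower_Taylor_quadratic[of "\<epsilon> * R"] \<epsilon> R0 by (smt (verit) mult_pos_pos)
          then have "1 / exp (\<epsilon> * R) \<le> 1 / ((\<epsilon> * R)\<^sup>2 / 2)"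
            using \<epsilon> R0 by (intro frac_le) auto
          then show ?thesis by (simp only: exp_minus inverse_eq_divide)
        qed
        finally show "exp (- (R * (t + k))) \<le> 2 / (\<epsilon> * R)\<^sup>2" by simp
      qed (use pos in simp)
      also have "\<dots> = 8 / (\<alpha> * \<epsilon>\<^sup>2 * R\<^sup>2)" by (simp add: power_mult_distrib)
      finally have "exp (Re s * t) / norm (\<Delta> s) \<le> 8 / (\<alpha> * \<epsilon>\<^sup>2 * R\<^sup>2)" .
      then have "exp (Re s * t) * norm (F s) \<le> 8 / (\<alpha> * \<epsilon>\<^sup>2 * R\<^sup>2) + 2 / R * exp (- (\<bar>t\<bar> * R))"
        using F_left[of s "R / 2"] half s R0 by simp
      then show ?thesis by (simp add: norm_mult norm_exp_eq_Re)
    qed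
    have right: "norm (exp (s * of_real t) * F s) \<le> 2 / R * exp (- (\<bar>t\<bar> * R)) + 4 * A / R\<^sup>2"
      if s: "Re s = R" "\<bar>Im s\<bar> \<le> R" for s
    proof -
      have "R - \<bar>a\<bar> \<le> \<bar>Re (s - of_real a)\<bar>" using s by auto
      then have half: "R / 2 \<le> norm (s - of_real a)"
        using abs_Re_le_cmod[of "s - of_real a"] aR by linarith
      have Rn: "R \<le> norm s" using s abs_Re_le_cmod[of s] by simp
      have "\<Delta> s \<noteq> 0" using nz s R0 by (auto simp: bd)
      from F_right[OF _ Rn _ half this] show ?thesis
        using s R0 by (simp add: norm_mult norm_exp_eq_Re power2_eq_square)
    qed
    obtain J1 where J1: "((\<lambda>x. exp (- (\<epsilon> / 2 * \<bar>x\<bar>))) has_integral J1) {-R..R}" "J1 \<le> 4 / \<epsilon>"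
      using exp_neg_abs_integral[of "\<epsilon> / 2" R] \<epsilon> R0 by auto
    obtain J where J: "((\<lambda>x. exp (- (\<bar>t\<bar> * \<bar>x\<bar>))) has_integral J) {-R..R}" "J \<le> 2 * R"
        "\<bar>t\<bar> > 0 \<Longrightarrow> J \<le> 2 / \<bar>t\<bar>"
      using exp_neg_abs_integral[of "\<bar>t\<bar>" R] R0 by (metis abs_ge_zero less_imp_le)
    have g_int: "(g has_integral (w * J1 + 2 / R * J + (2 * A / R\<^sup>2) * (R - (- R)))) {-R..R}"
      unfolding g_def
      by (intro has_integral_add has_integral_mult_right J1 J)
        (use has_integral_const_real[of "2 * A / R\<^sup>2" "-R" R] R0 in \<open>simp add: mult.commute\<close>)
    define \<Gamma> where "\<Gamma> = rectpath (Complex (-R) (-R)) (Complex R R)"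
    have img: "path_image \<Gamma> = bd"
      unfolding \<Gamma>_def bd_def by (rule path_image_rectpath_cbox_minus_box) (use R0 in auto)
    have \<Delta>_cont: "continuous_on bd \<Delta>"
      by (intro holomorphic_on_imp_continuous_on char_fun_holomorphic)
    have c1: "continuous_on bd (\<lambda>s. exp (s * of_real t) / \<Delta> s)"
      by (intro continuous_intros \<Delta>_cont) (use nz in auto)
    have c2: "continuous_on bd (\<lambda>s. exp (s * of_real t) / (s - of_real a))"
      by (intro continuous_intros) (use nz in auto)
    have F_eq: "exp (s * of_real t) * F s = exp (s * of_real t) / \<Delta> s
        - (if t > 0 then exp (s * of_real t) / (s - of_real a) else 0)" for s
      by (simp add: F_def algebra_simps)
    have F_cont: "continuous_on bd (\<lambda>s. exp (s * of_real t) * F s)"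
      unfolding F_eq using c1 c2 by (cases "t > 0") (auto intro!: continuous_intros)
    have bound: "norm (contour_integral \<Gamma> (\<lambda>s. exp (s * of_real t) * F s))
        \<le> 2 * (w * J1 + 2 / R * J + (2 * A / R\<^sup>2) * (R - (- R)))
          + 2 * R * ((8 / (\<alpha> * \<epsilon>\<^sup>2 * R\<^sup>2) + 2 / R * exp (- (\<bar>t\<bar> * R))) + (2 / R * exp (- (\<bar>t\<bar> * R)) + 4 * A / R\<^sup>2))"
      unfolding \<Gamma>_def
      by (rule contour_integral_square_bound[OF R0 _ horizontal g_int left right])
        (use F_cont img in \<open>auto simp: \<Gamma>_def\<close>)
    also have "\<dots> = 2 * (w * J1) + 4 / R * J + 8 * exp (- (\<bar>t\<bar> * R)) + (16 * A + 16 / (\<alpha> * \<epsilon>\<^sup>2)) / R"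
      using R0 pos \<epsilon> by (simp add: field_simps power2_eq_square)
    also have "2 * (w * J1) \<le> 2 * (w * (4 / \<epsilon>))"
      using J1 w by (intro mult_left_mono) auto
    also have "2 * (w * (4 / \<epsilon>)) + 4 / R * J + 8 * exp (- (\<bar>t\<bar> * R)) + (16 * A + 16 / (\<alpha> * \<epsilon>\<^sup>2)) / R
        = \<rho> R + (4 / R * J + 8 * exp (- (\<bar>t\<bar> * R)))"
      by (simp add: \<rho>_def w_def)
    finally have bound': "norm (contour_integral \<Gamma> (\<lambda>s. exp (s * of_real t) * F s))
        \<le> \<rho> R + (4 / R * J + 8 * exp (- (\<bar>t\<bar> * R)))" by simp
    have res1: "contour_integral \<Gamma> (\<lambda>s. exp (s * of_real t) / \<Delta> s) = 2 * of_real pi * \<i> * square_sum R t"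
      unfolding \<Gamma>_def square_sum_def
      by (rule square_contour_residues[OF char_fun_has_field_derivative simple R0])
        (use nz in \<open>auto simp: bd_def\<close>)
    have "contour_integral \<Gamma> (\<lambda>s. exp (s * of_real t) / (s - of_real a))
        = 2 * of_real pi * \<i> * (\<Sum>p | p - of_real a = 0 \<and> p \<in> box (Complex (-R) (-R)) (Complex R R). exp (p * of_real t) / 1)"
      unfolding \<Gamma>_def
      by (rule square_contour_residues[OF _ _ R0])
        (use nz in \<open>auto simp: bd_def intro!: derivative_eq_intros\<close>)
    also have "{p. p - of_real a = 0 \<and> p \<in> box (Complex (-R) (-R)) (Complex R R)} = {of_real a}"
      using aR by (auto simp: in_box_complex_iff)
    finally have res2: "contour_integral \<Gamma> (\<lambda>s. exp (s * of_real t) / (s - of_real a))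
        = 2 * of_real pi * \<i> * exp (of_real (a * t))" by simp
    have gint: "(\<lambda>s. exp (s * of_real t) / \<Delta> s) contour_integrable_on \<Gamma>"
      "(\<lambda>s. exp (s * of_real t) / (s - of_real a)) contour_integrable_on \<Gamma>"
      using c1 c2 img unfolding \<Gamma>_def rectpath_def Let_def
      by (auto simp: path_image_join intro!: contour_integrable_continuous_linepath elim: continuous_on_subset)
    have "contour_integral \<Gamma> (\<lambda>s. exp (s * of_real t) * F s)
        = 2 * of_real pi * \<i> * (square_sum R t - step_exp t)"
      unfolding F_eq using gint
      by (cases "t > 0") (simp_all add: res1 res2 step_exp_def contour_integral_diff right_diff_distrib)
    then have "2 * pi * norm (square_sum R t - step_exp t) \<le> \<rho> R + (4 / R * J + 8 * exp (- (\<bar>t\<bar> * R)))"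
      using bound' by (simp add: norm_mult)
    moreover have "1 * norm (square_sum R t - step_exp t) \<le> 2 * pi * norm (square_sum R t - step_exp t)"
      by (intro mult_right_mono) (use pi_gt3 in auto)
    ultimately have fin: "norm (square_sum R t - step_exp t) \<le> \<rho> R + (4 / R * J + 8 * exp (- (\<bar>t\<bar> * R)))"
      by simp
    have "4 / R * J \<le> 4 / R * (2 * R)" using J R0 by (intro mult_left_mono) auto
    then have "4 / R * J \<le> 8" using R0 by simp
    moreover have "exp (- (\<bar>t\<bar> * R)) \<le> 1" using R0 by simp
    ultimately have b1: "norm (square_sum R t - step_exp t) \<le> \<rho> R + 16" using fin by linarith
    have b2: "norm (square_sum R t - step_exp t) \<le> \<rho> R + 16 / (R * \<bar>t\<bar>)" if "t \<noteq> 0"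
    proof -
      have "4 / R * J \<le> 4 / R * (2 / \<bar>t\<bar>)" using J(3) that R0 by (intro mult_left_mono) auto
      then have "4 / R * J \<le> 8 / (R * \<bar>t\<bar>)" by simp
      moreover have "exp (- (\<bar>t\<bar> * R)) \<le> 1 / (R * \<bar>t\<bar>)"
      proof -
        have "\<bar>t\<bar> * R \<le> exp (\<bar>t\<bar> * R)" using exp_ge_add_one_self[of "\<bar>t\<bar> * R"] by linarith
        then have "1 / exp (\<bar>t\<bar> * R) \<le> 1 / (\<bar>t\<bar> * R)"
          using that R0 by (intro frac_le) auto
        then show ?thesis by (simp only: exp_minus inverse_eq_divide mult.commute)
      qed
      ultimately show ?thesis using fin by (simp add: add_divide_distrib)
    qed
    show ?thesis using b1 b2 by blast
  qed
  show ?thesis using \<rho> main by blast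
qed

section \<open>Symmetric partial sums and squares\<close>

text \<open>
  Strips of height \<open>2 pi / (3 m h)\<close> contain at most one root far to the left. The band above
  the height \<open>R\<close> is three times as high and may meet four of them, and so may its mirror
  image.
\<close>

lemma few_high_roots:
  "\<exists>c. \<forall>R T. T \<subseteq> {s. \<Delta> s = 0 \<and> Re s \<le> - c \<and> R \<le> \<bar>Im s\<bar> \<and> \<bar>Im s\<bar> \<le> R + 2 * pi / (real m * h)}
    \<longrightarrow> finite T \<and> card T \<le> 8"
proof -
  obtain c where c: "\<And>y. inj_on \<Delta> {s. Re s \<le> - c \<and> \<bar>Im s - y\<bar> \<le> pi / (3 * real m * h)}"
    using char_fun_inj_on_strip by blast
  define \<kappa> where "\<kappa> = 2 * pi / (3 * real m * h)"
  have \<kappa>: "\<kappa> > 0" using h_pos m_range by (simp add: \<kappa>_def)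
  have period: "2 * pi / (real m * h) = 3 * \<kappa>" using h_pos m_range by (simp add: \<kappa>_def)
  have "finite T \<and> card T \<le> 8"
    if T: "T \<subseteq> {s. \<Delta> s = 0 \<and> Re s \<le> - c \<and> R \<le> \<bar>Im s\<bar> \<and> \<bar>Im s\<bar> \<le> R + 3 * \<kappa>}" for R T
  proof -
    define f where "f s = \<lfloor>Im s / \<kappa>\<rfloor>" for s
    have inj: "inj_on f T"
    proof (rule inj_onI)
      fix s s' assume s: "s \<in> T" "s' \<in> T" "f s = f s'"
      define y where "y = (of_int (f s) + 1/2) * \<kappa>"
      have near: "\<bar>Im p - y\<bar> \<le> pi / (3 * real m * h)" if "f p = f s" for p
      proof -
        have "of_int (f s) \<le> Im p / \<kappa>" "Im p / \<kappa> < of_int (f s) + 1"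
          unfolding that[symmetric] using floor_correct[of "Im p / \<kappa>"] by (simp_all add: f_def)
        then have "of_int (f s) * \<kappa> \<le> Im p" "Im p \<le> (of_int (f s) + 1) * \<kappa>"
          using \<kappa> by (simp_all add: pos_le_divide_eq pos_divide_less_eq)
        moreover have "pi / (3 * real m * h) = \<kappa> / 2" by (simp add: \<kappa>_def)
        ultimately show ?thesis by (simp add: y_def abs_le_iff algebra_simps)
      qed
      have root: "\<Delta> p = 0 \<and> Re p \<le> - c" if "p \<in> T" for p using T that by blast
      show "s = s'"
        by (rule inj_onD[OF c[of y]]) (use root near s in auto)
    qed
    define I where "I = {\<lfloor>R / \<kappa>\<rfloor>..\<lfloor>R / \<kappa>\<rfloor> + 3} \<union> {\<lfloor>(- R - 3 * \<kappa>) / \<kappa>\<rfloor>..\<lfloor>(- R - 3 * \<kappa>) / \<kappa>\<rfloor> + 3}"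
    have "f s \<in> I" if "s \<in> T" for s
    proof -
      have s: "R \<le> \<bar>Im s\<bar>" "\<bar>Im s\<bar> \<le> R + 3 * \<kappa>" using that T by auto
      have in_range: "\<lfloor>x / \<kappa>\<rfloor> \<in> {\<lfloor>l / \<kappa>\<rfloor>..\<lfloor>l / \<kappa>\<rfloor> + 3}" if "l \<le> x" "x \<le> l + 3 * \<kappa>" for x l
      proof -
        have "x / \<kappa> \<le> (l + 3 * \<kappa>) / \<kappa>" using that \<kappa> by (intro divide_right_mono) auto
        also have "\<dots> = l / \<kappa> + 3" using \<kappa> by (simp add: add_divide_distrib)
        finally have "\<lfloor>x / \<kappa>\<rfloor> \<le> \<lfloor>l / \<kappa> + of_int 3\<rfloor>" by (intro floor_mono) simp
        moreover have "\<lfloor>l / \<kappa>\<rfloor> \<le> \<lfloor>x / \<kappa>\<rfloor>" using that \<kappa> by (intro floor_mono divide_right_mono) auto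
        ultimately show ?thesis by simp
      qed
      show ?thesis
      proof (cases "Im s \<ge> 0")
        case True
        then show ?thesis using in_range[of R "Im s"] s by (simp add: I_def f_def)
      next
        case False
        then show ?thesis using in_range[of "- R - 3 * \<kappa>" "Im s"] s by (simp add: I_def f_def)
      qed
    qed
    then have sub: "f ` T \<subseteq> I" by auto
    have "finite I" by (simp add: I_def)
    have "card I \<le> 4 + 4"
      unfolding I_def by (rule order_trans[OF card_Un_le]) simp
    then show ?thesis
      using card_inj_on_le[OF inj sub \<open>finite I\<close>] inj_on_finite[OF inj sub \<open>finite I\<close>] by simp
  qed
  then show ?thesis unfolding period by blast
qed

lemma roots_in_square:
  "\<exists>R0. \<forall>R\<ge>R0. \<forall>s. \<Delta> s = 0 \<longrightarrow> \<bar>Im s\<bar> < R \<longrightarrow> s \<in> box (Complex (-R) (-R)) (Complex R R)"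
proof -
  obtain R2 where R2: "\<And>s. Re s \<le> - R2 \<Longrightarrow> \<bar>Im s\<bar> \<le> - Re s \<Longrightarrow> \<bar>ad m\<bar> / 4 * lead_size s \<le> norm (\<Delta> s)"
    using char_fun_far_left by blast
  define R0 where "R0 = Max {1, R2, 2 * (\<bar>a\<bar> + (\<Sum>j=1..N. \<bar>ad j\<bar>))}"
  have "s \<in> box (Complex (-R) (-R)) (Complex R R)" if R: "R \<ge> R0" and s: "\<Delta> s = 0" "\<bar>Im s\<bar> < R" for R s
  proof -
    have Rs: "R \<ge> 1" "R \<ge> R2" "R \<ge> 2 * (\<bar>a\<bar> + (\<Sum>j=1..N. \<bar>ad j\<bar>))"
      using R by (auto simp: R0_def)
    have "- R < Re s"
    proof (rule ccontr)
      assume "\<not> - R < Re s"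
      then have "\<bar>ad m\<bar> / 4 * lead_size s \<le> norm (\<Delta> s)" using s Rs by (intro R2) auto
      then show False using s lead_nonzero lead_size_pos[of s] by (simp add: mult_le_0_iff)
    qed
    moreover have "Re s < R"
    proof (rule ccontr)
      assume "\<not> Re s < R"
      then have "R \<le> norm s" "Re s \<ge> 0" using abs_Re_le_cmod[of s] Rs by linarith+
      then have "norm s / 2 \<le> norm (\<Delta> s)" using Rs by (intro char_fun_right) auto
      then show False using s \<open>R \<le> norm s\<close> Rs by simp
    qed
    ultimately show ?thesis using s by (auto simp: in_box_complex_iff abs_less_iff)
  qed
  then show ?thesis by blast
qed

lemma level_below:
  "\<exists>R. ad m * sin (real m * h * R) = \<bar>ad m\<bar> \<and> R \<le> y \<and> y \<le> R + 2 * pi / (real m * h)"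
proof -
  define k where "k = real m * h"
  have k: "k > 0" using mh_pos by (simp add: k_def)
  define n where "n = \<lfloor>(k * y - sgn (ad m) * (pi / 2)) / (2 * pi)\<rfloor>"
  define R where "R = (2 * pi * of_int n + sgn (ad m) * (pi / 2)) / k"
  have kR: "k * R = 2 * pi * of_int n + sgn (ad m) * (pi / 2)" using k by (simp add: R_def)
  have "sin (k * R) = sin (sgn (ad m) * (pi / 2))"
    unfolding kR sin_add by (simp only: sin_int_2pin cos_int_2pin)
  also have "\<dots> = sgn (ad m)" using lead_nonzero by (simp add: sgn_if)
  finally have "ad m * sin (k * R) = \<bar>ad m\<bar>" by (simp add: abs_sgn)
  moreover have "of_int n \<le> (k * y - sgn (ad m) * (pi / 2)) / (2 * pi)"
    "(k * y - sgn (ad m) * (pi / 2)) / (2 * pi) < of_int n + 1"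
    unfolding n_def by linarith+
  then have "of_int n * (2 * pi) \<le> k * y - sgn (ad m) * (pi / 2)"
    "k * y - sgn (ad m) * (pi / 2) < (of_int n + 1) * (2 * pi)"
    by (simp_all add: pos_le_divide_eq pos_divide_less_eq)
  then have "k * R \<le> k * y" "k * y \<le> k * (R + 2 * pi / k)"
    using kR k by (simp_all add: algebra_simps)
  then have "R \<le> y" "y \<le> R + 2 * pi / k" using k by simp_all
  ultimately show ?thesis unfolding k_def by blast
qed

end

locale numbered_delay_system = delay_system +
  fixes S :: "int \<Rightarrow> complex"
  assumes numbering: "root_numbering N h a ad S"
    and simple_roots: "\<And>k. coeff_denom N h ad (S k) \<noteq> 0"
begin

definition partial_sum :: "nat \<Rightarrow> real \<Rightarrow> complex" where
  "partial_sum n t = (\<Sum>k=- int n..int n. coeff_C N h ad (S k) * exp (S k * of_real t))"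

lemma S_bij: "bij_betw S UNIV {s. \<Delta> s = 0}"
  using numbering unfolding root_numbering_def by (rule conjunct1)

lemma S_inj: "inj S"
  using S_bij by (rule bij_betw_imp_inj_on)

lemma S_root: "\<Delta> (S k) = 0"
  using bij_betwE[OF S_bij] by blast

lemma root_S: "\<Delta> s = 0 \<Longrightarrow> \<exists>k. s = S k"
  using bij_betw_imp_surj_on[OF S_bij] by blast

lemma root_simple: "\<Delta> s = 0 \<Longrightarrow> \<Delta>' s \<noteq> 0"
  using root_S[of s] simple_roots by blast

lemma finite_low_indices: "finite {k. \<bar>Im (S k)\<bar> \<le> Y}"
proof -
  obtain R0 where R0: "\<And>R s. R \<ge> R0 \<Longrightarrow> \<Delta> s = 0 \<Longrightarrow> \<bar>Im s\<bar> < R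
      \<Longrightarrow> s \<in> box (Complex (-R) (-R)) (Complex R R)"
    using roots_in_square by blast
  define R where "R = max R0 (Y + 1)"
  have "S ` {k. \<bar>Im (S k)\<bar> \<le> Y} \<subseteq> {z \<in> cbox (Complex (-R) (-R)) (Complex R R). \<Delta> z = 0}"
  proof
    fix z assume "z \<in> S ` {k. \<bar>Im (S k)\<bar> \<le> Y}"
    then obtain k where k: "z = S k" "\<bar>Im (S k)\<bar> \<le> Y" by auto
    then have z: "\<Delta> z = 0" "\<bar>Im z\<bar> < R" "R0 \<le> R"
      using S_root by (auto simp: R_def)
    then have "z \<in> box (Complex (-R) (-R)) (Complex R R)" by (intro R0)
    then show "z \<in> {z \<in> cbox (Complex (-R) (-R)) (Complex R R). \<Delta> z = 0}"
      using z(1) by (auto simp: in_box_complex_iff in_cbox_complex_iff)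
  qed
  moreover have "finite {z \<in> cbox (Complex (-R) (-R)) (Complex R R). \<Delta> z = 0}"
    by (rule simple_zeros_finite[OF char_fun_has_field_derivative root_simple compact_cbox])
  ultimately have "finite (S ` {k. \<bar>Im (S k)\<bar> \<le> Y})" using finite_subset by metis
  then show ?thesis by (rule finite_imageD) (rule inj_on_subset[OF S_inj], simp)
qed

lemma eventually_high: "eventually (\<lambda>n. \<bar>Im (S (int n))\<bar> > Y) sequentially"
proof -
  have "finite (nat ` {k. \<bar>Im (S k)\<bar> \<le> Y})" using finite_low_indices by simp
  then obtain n0 where n0: "\<And>n. n \<in> nat ` {k. \<bar>Im (S k)\<bar> \<le> Y} \<Longrightarrow> n < n0"
    by (auto simp: finite_nat_set_iff_bounded)
  show ?thesis
  proof (rule eventually_sequentiallyI[of n0])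
    fix n assume n: "n0 \<le> n"
    show "Y < \<bar>Im (S (int n))\<bar>"
    proof (rule ccontr)
      assume "\<not> ?thesis"
      then have "nat (int n) \<in> nat ` {k. \<bar>Im (S k)\<bar> \<le> Y}" by (intro imageI) simp
      then show False using n0 n by fastforce
    qed
  qed
qed

text \<open>
  Only indices of different modulus are ordered by the numbering, so \<open>n\<close> and \<open>- n\<close> may come in
  either order; the larger of their two heights separates the indices.
\<close>

lemma eventually_separated:
  "eventually (\<lambda>n. \<exists>y\<ge>Y. (\<forall>i. \<bar>i\<bar> \<le> int n \<longrightarrow> \<bar>Im (S i)\<bar> \<le> y) \<and> (\<forall>j. \<bar>j\<bar> > int n \<longrightarrow> y \<le> \<bar>Im (S j)\<bar>)) sequentially"
proof -
  obtain M where M: "\<And>i j. M \<le> \<bar>i\<bar> \<Longrightarrow> \<bar>i\<bar> < \<bar>j\<bar> \<Longrightarrow> \<bar>Im (S i)\<bar> \<le> \<bar>Im (S j)\<bar>"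
    using numbering by (auto simp: root_numbering_def)
  define W where "W = Max (insert Y ((\<lambda>i. \<bar>Im (S i)\<bar>) ` {-M..M}))"
  have W: "Y \<le> W" "\<And>i. \<bar>i\<bar> \<le> M \<Longrightarrow> \<bar>Im (S i)\<bar> \<le> W"
    unfolding W_def by (rule Max_ge; force simp: abs_le_iff)+
  have "eventually (\<lambda>n. \<bar>Im (S (int n))\<bar> > W \<and> n \<ge> nat M) sequentially"
    by (intro eventually_conj eventually_high eventually_ge_at_top)
  then show ?thesis
  proof (eventually_elim)
    fix n assume n: "\<bar>Im (S (int n))\<bar> > W \<and> n \<ge> nat M"
    define y where "y = max \<bar>Im (S (int n))\<bar> \<bar>Im (S (- int n))\<bar>"
    have yn: "\<bar>Im (S (int n))\<bar> \<le> y" "\<bar>Im (S (- int n))\<bar> \<le> y"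
      unfolding y_def by (rule max.cobounded1, rule max.cobounded2)
    have "Y \<le> y" using n W(1) yn(1) by linarith
    moreover have "\<bar>Im (S i)\<bar> \<le> y" if "\<bar>i\<bar> \<le> int n" for i
    proof (cases "\<bar>i\<bar> = int n")
      case True
      then have "i = int n \<or> i = - int n" by linarith
      then show ?thesis using yn by auto
    next
      case False
      show ?thesis
      proof (cases "\<bar>i\<bar> \<le> M")
        case True
        then show ?thesis using W(2)[of i] n yn(1) by linarith
      next
        case outer: False
        then have "\<bar>Im (S i)\<bar> \<le> \<bar>Im (S (int n))\<bar>" using False that by (intro M) auto
        then show ?thesis using yn(1) by linarith
      qed
    qed
    moreover have "y \<le> \<bar>Im (S j)\<bar>" if "\<bar>j\<bar> > int n" for j
    proof -
      have "M \<le> int n" using n by linarith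
      then have "\<bar>Im (S (int n))\<bar> \<le> \<bar>Im (S j)\<bar>" "\<bar>Im (S (- int n))\<bar> \<le> \<bar>Im (S j)\<bar>"
        using that by (auto intro!: M)
      then show ?thesis by (simp only: y_def max.bounded_iff)
    qed
    ultimately show "\<exists>y\<ge>Y. (\<forall>i. \<bar>i\<bar> \<le> int n \<longrightarrow> \<bar>Im (S i)\<bar> \<le> y) \<and> (\<forall>j. \<bar>j\<bar> > int n \<longrightarrow> y \<le> \<bar>Im (S j)\<bar>)"
      by blast
  qed
qed

text \<open>
  Take the largest admissible \<open>R\<close> below a height that separates the first indices from the
  others. The partial sum contains all roots below \<open>R\<close>, and its further roots lie in one band.
  They lie far to the left, where \<open>\<bar>\<Delta>'\<bar>\<close> is at least a multiple of \<open>exp (- m h Re s)\<close>, so that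
  their terms are of size \<open>exp ((t + m h) Re s)\<close>.
\<close>

lemma partial_sum_near_square_sum:
  assumes \<epsilon>: "\<epsilon> > 0" and \<delta>: "\<delta> > 0"
  shows "eventually (\<lambda>n. \<exists>R\<ge>Y. ad m * sin (real m * h * R) = \<bar>ad m\<bar> \<and>
    (\<forall>t\<ge>\<epsilon> - real m * h. norm (partial_sum n t - square_sum R t) \<le> \<delta>)) sequentially"
proof -
  define b where "b = real m * h * \<bar>ad m\<bar> / 2"
  have b: "b > 0" using mh_pos lead_nonzero by (simp add: b_def)
  obtain c1 where c1: "\<forall>R T. T \<subseteq> {s. \<Delta> s = 0 \<and> Re s \<le> - c1 \<and> R \<le> \<bar>Im s\<bar> \<and> \<bar>Im s\<bar> \<le> R + 2 * pi / (real m * h)}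
      \<longrightarrow> finite T \<and> card T \<le> 8"
    using few_high_roots by (rule exE)
  obtain c2 where c2: "\<And>s. Re s \<le> - c2 \<Longrightarrow> b * lead_size s \<le> norm (\<Delta>' s)"
    using coeff_denom_far_left unfolding b_def by blast
  obtain R0 where R0: "\<And>R s. R \<ge> R0 \<Longrightarrow> \<Delta> s = 0 \<Longrightarrow> \<bar>Im s\<bar> < R
      \<Longrightarrow> s \<in> box (Complex (-R) (-R)) (Complex R R)"
    using roots_in_square by blast
  \<comment> \<open>The third entry makes each of the at most eight additional terms smaller than \<open>\<delta> / 8\<close>.\<close>
  define c where "c = Max {c1, c2, 8 / (b * \<delta> * \<epsilon>)}"
  have c: "c1 \<le> c" "c2 \<le> c" "8 / (b * \<delta> * \<epsilon>) \<le> c" by (auto simp: c_def)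
  obtain K where K: "\<And>s. \<Delta> s = 0 \<Longrightarrow> K \<le> \<bar>Im s\<bar> \<Longrightarrow> Re s \<le> - c"
    using high_roots_left by blast
  define Y' where "Y' = Max {Y, R0, K} + 2 * pi / (real m * h)"
  from eventually_separated[of Y'] show ?thesis
  proof eventually_elim
    fix n assume "\<exists>y\<ge>Y'. (\<forall>i. \<bar>i\<bar> \<le> int n \<longrightarrow> \<bar>Im (S i)\<bar> \<le> y) \<and> (\<forall>j. \<bar>j\<bar> > int n \<longrightarrow> y \<le> \<bar>Im (S j)\<bar>)"
    then obtain y where y: "y \<ge> Y'" "\<And>i. \<bar>i\<bar> \<le> int n \<Longrightarrow> \<bar>Im (S i)\<bar> \<le> y"
        "\<And>j. \<bar>j\<bar> > int n \<Longrightarrow> y \<le> \<bar>Im (S j)\<bar>" by blast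
    obtain R where R: "ad m * sin (real m * h * R) = \<bar>ad m\<bar>" "R \<le> y" "y \<le> R + 2 * pi / (real m * h)"
      using level_below by blast
    have "Max {Y, R0, K} \<le> R" using y(1)[unfolded Y'_def] R(3) by linarith
    then have RY: "Y \<le> R" "R0 \<le> R" "K \<le> R" by auto
    define P where "P = S ` {- int n..int n}"
    define T where "T = {p \<in> P. R \<le> \<bar>Im p\<bar>}"
    define Z where "Z = {p. \<Delta> p = 0 \<and> p \<in> box (Complex (-R) (-R)) (Complex R R)}"
    have Z: "Z = {p. \<Delta> p = 0 \<and> \<bar>Im p\<bar> < R}"
      using R0[OF RY(2)] by (auto simp: Z_def in_box_complex_iff abs_less_iff)
    have "P = Z \<union> T"
    proof (intro equalityI subsetI)
      fix p assume "p \<in> P"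
      then show "p \<in> Z \<union> T" using S_root by (auto simp: Z T_def P_def)
    next
      fix p assume "p \<in> Z \<union> T"
      then show "p \<in> P"
      proof
        assume p: "p \<in> Z"
        then obtain k where k: "p = S k" using root_S by (auto simp: Z)
        then have "\<not> \<bar>k\<bar> > int n" using y(3)[of k] p R(2) by (auto simp: Z)
        then have "k \<in> {- int n..int n}" by (auto simp: abs_le_iff not_less)
        then show ?thesis using k unfolding P_def by blast
      qed (simp add: T_def)
    qed
    moreover have "Z \<inter> T = {}" by (auto simp: Z T_def)
    moreover have "finite P" by (simp add: P_def)
    ultimately have split: "(\<Sum>p\<in>P. F p) = (\<Sum>p\<in>Z. F p) + (\<Sum>p\<in>T. F p)" for F :: "complex \<Rightarrow> complex"
      by (simp add: sum.union_disjoint)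
    have T_sub: "T \<subseteq> {s. \<Delta> s = 0 \<and> Re s \<le> - c \<and> R \<le> \<bar>Im s\<bar> \<and> \<bar>Im s\<bar> \<le> R + 2 * pi / (real m * h)}"
    proof
      fix p assume p: "p \<in> T"
      then obtain k where k: "p = S k" "\<bar>k\<bar> \<le> int n" by (auto simp: T_def P_def)
      then have "\<Delta> p = 0" "\<bar>Im p\<bar> \<le> y" using S_root y(2) by auto
      moreover have "R \<le> \<bar>Im p\<bar>" using p by (simp add: T_def)
      ultimately show "p \<in> {s. \<Delta> s = 0 \<and> Re s \<le> - c \<and> R \<le> \<bar>Im s\<bar> \<and> \<bar>Im s\<bar> \<le> R + 2 * pi / (real m * h)}"
        using K[of p] RY R(3) by auto
    qed
    then have "T \<subseteq> {s. \<Delta> s = 0 \<and> Re s \<le> - c1 \<and> R \<le> \<bar>Im s\<bar> \<and> \<bar>Im s\<bar> \<le> R + 2 * pi / (real m * h)}"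
      using c(1) by (auto intro: order_trans)
    then have "finite T \<and> card T \<le> 8" using c1 by blast
    then have T: "finite T" "card T \<le> 8" by auto
    have "norm (partial_sum n t - square_sum R t) \<le> \<delta>" if t: "t \<ge> \<epsilon> - real m * h" for t
    proof -
      have "partial_sum n t = (\<Sum>p\<in>P. exp (p * of_real t) / \<Delta>' p)"
        unfolding partial_sum_def P_def
        by (subst sum.reindex) (auto intro: inj_on_subset[OF S_inj] simp: coeff_C_def)
      also have "\<dots> = square_sum R t + (\<Sum>p\<in>T. exp (p * of_real t) / \<Delta>' p)"
        unfolding split by (simp add: square_sum_def Z_def)
      finally have "norm (partial_sum n t - square_sum R t) = norm (\<Sum>p\<in>T. exp (p * of_real t) / \<Delta>' p)"
        by simp
      also have "\<dots> \<le> (\<Sum>p\<in>T. \<delta> / 8)"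
      proof (rule sum_norm_le)
        fix p assume "p \<in> T"
        then have p: "Re p \<le> - c" using T_sub by auto
        have cpos: "0 < 8 / (b * \<delta> * \<epsilon>)" using b \<delta> \<epsilon> by simp
        have "norm (exp (p * of_real t) / \<Delta>' p) = exp (Re p * t) / norm (\<Delta>' p)"
          by (simp add: norm_divide norm_exp_eq_Re)
        also have "\<dots> \<le> exp (Re p * t) / (b * lead_size p)"
          using c2[of p] p c(2) b lead_size_pos[of p] by (intro frac_le) auto
        also have "exp (Re p * t) = exp (Re p * (t + real m * h)) * lead_size p"
          by (simp add: lead_size_def algebra_simps flip: exp_add)
        also have "exp (Re p * (t + real m * h)) * lead_size p / (b * lead_size p) = exp (Re p * (t + real m * h)) / b"
          using lead_size_pos[of p] by simp
        also have "\<dots> \<le> exp (- (c * \<epsilon>)) / b"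
        proof (intro divide_right_mono iffD2[OF exp_le_cancel_iff])
          have "Re p * (t + real m * h) \<le> Re p * \<epsilon>"
            using t p less_le_trans[OF cpos c(3)] by (intro mult_left_mono_neg) auto
          also have "\<dots> \<le> - c * \<epsilon>" using p \<epsilon> by (intro mult_right_mono) auto
          finally show "Re p * (t + real m * h) \<le> - (c * \<epsilon>)" by simp
        qed (use b in simp)
        also have "\<dots> \<le> \<delta> / 8"
        proof -
          have ce: "8 / (b * \<delta>) \<le> c * \<epsilon>"
            using mult_right_mono[OF c(3), of \<epsilon>] \<epsilon> by simp
          also have "\<dots> \<le> exp (c * \<epsilon>)" using exp_ge_add_one_self[of "c * \<epsilon>"] by linarith
          finally have "1 / exp (c * \<epsilon>) \<le> 1 / (8 / (b * \<delta>))"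
            using b \<delta> by (intro frac_le) auto
          then have "exp (- (c * \<epsilon>)) \<le> b * \<delta> / 8" by (simp add: exp_minus inverse_eq_divide)
          then show ?thesis using b by (simp add: pos_divide_le_eq mult.commute)
        qed
        finally show "norm (exp (p * of_real t) / \<Delta>' p) \<le> \<delta> / 8" .
      qed
      also have "\<dots> = real (card T) * (\<delta> / 8)" by simp
      also have "\<dots> \<le> 8 * (\<delta> / 8)" using T \<delta> by (intro mult_right_mono) auto
      finally show ?thesis by simp
    qed
    then show "\<exists>R\<ge>Y. ad m * sin (real m * h * R) = \<bar>ad m\<bar> \<and>
        (\<forall>t\<ge>\<epsilon> - real m * h. norm (partial_sum n t - square_sum R t) \<le> \<delta>)"
      using RY R by blast
  qed
qed

lemma partial_sum_bounded_first_delay: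
  assumes \<epsilon>: "0 < \<epsilon>" "\<epsilon> \<le> real m * h"
  shows "\<exists>B. eventually (\<lambda>n. \<forall>t\<in>{\<epsilon> - real m * h..h}. norm (partial_sum n t) \<le> B) sequentially"
proof -
  obtain \<rho> R0 where \<rho>: "(\<rho> \<longlongrightarrow> 0) at_top"
    and err: "\<forall>R\<ge>R0. ad m * sin (real m * h * R) = \<bar>ad m\<bar> \<longrightarrow> (\<forall>t\<in>{\<epsilon> - real m * h..h}.
      norm (square_sum R t - step_exp t) \<le> \<rho> R + 16 \<and>
      (t \<noteq> 0 \<longrightarrow> norm (square_sum R t - step_exp t) \<le> \<rho> R + 16 / (R * \<bar>t\<bar>)))"
    by (rule exE[OF square_sum_error[OF root_simple \<epsilon>]], assumption, elim exE conjE, rule that)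
  obtain Y where Y: "\<And>R. R \<ge> Y \<Longrightarrow> \<rho> R < 1"
    using order_tendstoD(2)[OF \<rho>, of 1] by (auto simp: eventually_at_top_linorder)
  have "eventually (\<lambda>n. \<forall>t\<in>{\<epsilon> - real m * h..h}. norm (partial_sum n t) \<le> 18 + exp (\<bar>a\<bar> * h)) sequentially"
    using partial_sum_near_square_sum[OF \<epsilon>(1) zero_less_one, of "max R0 Y"]
  proof eventually_elim
    fix n assume "\<exists>R\<ge>max R0 Y. ad m * sin (real m * h * R) = \<bar>ad m\<bar> \<and>
      (\<forall>t\<ge>\<epsilon> - real m * h. norm (partial_sum n t - square_sum R t) \<le> 1)"
    then obtain R where R: "R \<ge> R0" "R \<ge> Y" "ad m * sin (real m * h * R) = \<bar>ad m\<bar>"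
      "\<And>t. t \<ge> \<epsilon> - real m * h \<Longrightarrow> norm (partial_sum n t - square_sum R t) \<le> 1" by auto
    show "\<forall>t\<in>{\<epsilon> - real m * h..h}. norm (partial_sum n t) \<le> 18 + exp (\<bar>a\<bar> * h)"
    proof
      fix t assume t: "t \<in> {\<epsilon> - real m * h..h}"
      have "norm (step_exp t) \<le> exp (\<bar>a\<bar> * h)"
      proof (cases "t > 0")
        case True
        have "a * t \<le> \<bar>a\<bar> * h" using t True by (intro mult_mono) auto
        then show ?thesis using True by (simp add: step_exp_def norm_exp_eq_Re)
      qed (simp add: step_exp_def)
      moreover have "norm (square_sum R t - step_exp t) \<le> 17" 
        using err[rule_format, OF R(1,3) t, THEN conjunct1] Y[OF R(2)] by linarith
      moreover have "norm (partial_sum n t - square_sum R t) \<le> 1" using R(4) t by simp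
      moreover have "norm (partial_sum n t) \<le> norm (partial_sum n t - square_sum R t)
          + (norm (square_sum R t - step_exp t) + norm (step_exp t))"
        using norm_triangle_ineq[of "partial_sum n t - square_sum R t" "square_sum R t"]
          norm_triangle_ineq[of "square_sum R t - step_exp t" "step_exp t"] by simp
      ultimately show "norm (partial_sum n t) \<le> 18 + exp (\<bar>a\<bar> * h)" by linarith
    qed
  qed
  then show ?thesis by blast
qed

lemma partial_sum_tendsto_first_delay:
  assumes t: "- (real m * h) < t" "t \<le> h" "t \<noteq> 0"
  shows "(\<lambda>n. partial_sum n t) \<longlonglongrightarrow> step_exp t"
proof -
  define \<epsilon> where "\<epsilon> = min (t + real m * h) (real m * h)"
  have \<epsilon>: "0 < \<epsilon>" "\<epsilon> \<le> real m * h" using t mh_pos by (auto simp: \<epsilon>_def)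
  have tin: "t \<in> {\<epsilon> - real m * h..h}" using t by (auto simp: \<epsilon>_def)
  obtain \<rho> R0 where \<rho>: "(\<rho> \<longlongrightarrow> 0) at_top"
    and err: "\<forall>R\<ge>R0. ad m * sin (real m * h * R) = \<bar>ad m\<bar> \<longrightarrow> (\<forall>t\<in>{\<epsilon> - real m * h..h}.
      norm (square_sum R t - step_exp t) \<le> \<rho> R + 16 \<and>
      (t \<noteq> 0 \<longrightarrow> norm (square_sum R t - step_exp t) \<le> \<rho> R + 16 / (R * \<bar>t\<bar>)))"
    by (rule exE[OF square_sum_error[OF root_simple \<epsilon>]], assumption, elim exE conjE, rule that)
  show ?thesis
  proof (rule tendstoI)
    fix e :: real assume e: "e > 0"
    obtain Y where Y: "\<And>R. R \<ge> Y \<Longrightarrow> \<rho> R < e / 4"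
      using order_tendstoD(2)[OF \<rho>, of "e / 4"] e by (auto simp: eventually_at_top_linorder)
    define Y' where "Y' = Max {R0, Y, 64 / (e * \<bar>t\<bar>)}"
    have "e / 4 > 0" using e by simp
    from partial_sum_near_square_sum[OF \<epsilon>(1) this, of Y']
    show "eventually (\<lambda>n. dist (partial_sum n t) (step_exp t) < e) sequentially"
    proof eventually_elim
      fix n assume "\<exists>R\<ge>Y'. ad m * sin (real m * h * R) = \<bar>ad m\<bar> \<and>
        (\<forall>t\<ge>\<epsilon> - real m * h. norm (partial_sum n t - square_sum R t) \<le> e / 4)"
      then obtain R where R: "R \<ge> Y'" "ad m * sin (real m * h * R) = \<bar>ad m\<bar>"
        "norm (partial_sum n t - square_sum R t) \<le> e / 4" using tin by auto
      then have R': "R \<ge> R0" "R \<ge> Y" "R \<ge> 64 / (e * \<bar>t\<bar>)" by (auto simp: Y'_def)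
      have pos: "0 < 64 / (e * \<bar>t\<bar>)" using e t by simp
      have "64 \<le> R * (e * \<bar>t\<bar>)" using R'(3) e t by (simp add: pos_divide_le_eq)
      moreover have "0 < R * \<bar>t\<bar>" using less_le_trans[OF pos R'(3)] t by simp
      ultimately have "16 / (R * \<bar>t\<bar>) \<le> e / 4"
        by (simp only: pos_divide_le_eq) (simp add: algebra_simps)
      then have "norm (square_sum R t - step_exp t) < e / 4 + e / 4"
        using err[rule_format, OF R'(1) R(2) tin, THEN conjunct2, rule_format, OF t(3)] Y[OF R'(2)] by linarith
      moreover have "dist (partial_sum n t) (step_exp t)
          \<le> norm (partial_sum n t - square_sum R t) + norm (square_sum R t - step_exp t)"
        unfolding dist_norm using norm_triangle_ineq[of "partial_sum n t - square_sum R t" "square_sum R t - step_exp t"] by simp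
      ultimately show "dist (partial_sum n t) (step_exp t) < e" using R(3) e by linarith
    qed
  qed
qed

section \<open>Convergence for all positive times\<close>

lemma partial_sum_continuous: "continuous_on A (partial_sum n)"
  unfolding partial_sum_def[abs_def] by (intro continuous_intros)

lemma partial_sum_dde:
  "(partial_sum n has_vector_derivative
    (of_real a * partial_sum n t + (\<Sum>j=1..N. of_real (ad j) * partial_sum n (t - real j * h)))) (at t)"
proof -
  have "((\<lambda>t. coeff_C N h ad (S k) * exp (S k * of_real t)) has_vector_derivative
      coeff_C N h ad (S k) * (1 * (exp (S k * of_real t) * S k))) (at t)" for k
  proof (rule has_vector_derivative_mult_right)
    have "((\<lambda>z. exp (S k * z)) has_field_derivative (exp (S k * of_real t) * S k)) (at (of_real t))"
      by (auto intro!: derivative_eq_intros)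
    from field_vector_diff_chain_at[OF has_vector_derivative_of_real[OF DERIV_ident] this]
    show "((\<lambda>t. exp (S k * of_real t)) has_vector_derivative 1 * (exp (S k * of_real t) * S k)) (at t)"
      by (simp add: o_def)
  qed
  then have deriv: "(partial_sum n has_vector_derivative
      (\<Sum>k=- int n..int n. coeff_C N h ad (S k) * (1 * (exp (S k * of_real t) * S k)))) (at t)"
    unfolding partial_sum_def[abs_def] by (intro has_vector_derivative_sum)
  have root: "coeff_C N h ad (S k) * (1 * (exp (S k * of_real t) * S k))
      = of_real a * (coeff_C N h ad (S k) * exp (S k * of_real t))
        + (\<Sum>j=1..N. of_real (ad j) * (coeff_C N h ad (S k) * exp (S k * of_real (t - real j * h))))" for k
  proof -
    have "S k = of_real a + (\<Sum>j=1..N. of_real (ad j) * exp (- (of_nat j * S k * of_real h)))"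
      using S_root[of k] by (simp add: char_fun_def algebra_simps)
    then have "exp (S k * of_real t) * S k
        = exp (S k * of_real t) * (of_real a + (\<Sum>j=1..N. of_real (ad j) * exp (- (of_nat j * S k * of_real h))))"
      by simp
    also have "\<dots> = of_real a * exp (S k * of_real t)
        + (\<Sum>j=1..N. of_real (ad j) * (exp (S k * of_real t) * exp (- (of_nat j * S k * of_real h))))"
      by (simp add: distrib_left sum_distrib_left mult_ac)
    also have "\<dots> = of_real a * exp (S k * of_real t)
        + (\<Sum>j=1..N. of_real (ad j) * exp (S k * of_real (t - real j * h)))"
      by (simp add: algebra_simps flip: exp_add)
    finally show ?thesis by (simp add: distrib_left sum_distrib_left mult_ac)
  qed
  have "(\<Sum>k=- int n..int n. coeff_C N h ad (S k) * (1 * (exp (S k * of_real t) * S k)))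
      = of_real a * partial_sum n t + (\<Sum>j=1..N. of_real (ad j) * partial_sum n (t - real j * h))"
    unfolding root sum.distrib partial_sum_def sum_distrib_left
    by (subst sum.swap) simp
  then show ?thesis using deriv by simp
qed

text \<open>
  The formula is started at time \<open>h / 2\<close>, not at \<open>0\<close>: then the history of a partial sum is
  taken on \<open>[h / 2 - m h, h / 2]\<close>, which stays in an interval on which they are bounded
  uniformly, and their initial value is taken away from the jump of \<open>\<Psi>\<close> at \<open>0\<close>.
\<close>

lemma homogeneous_shift:
  fixes y :: "real \<Rightarrow> complex"
  assumes \<Psi>: "state_transition N h a ad \<Psi>"
    and cont: "continuous_on {0..} y" and D: "countable D"
    and deriv: "\<And>t. t > 0 \<Longrightarrow> t \<notin> D \<Longrightarrow> (y has_vector_derivative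
        (of_real a * y t + (\<Sum>j=1..N. of_real (ad j) * y (t - real j * h)))) (at t)"
    and hist: "(\<lambda>\<tau>. y (\<tau> + h / 2)) absolutely_integrable_on {- (real N * h)..0}"
    and t: "t \<ge> 0"
  shows "y (t + h / 2) = of_real (\<Psi> t) * y (h / 2) + (\<Sum>j=1..N. of_real (ad j) *
    integral {- (real j * h)..0} (\<lambda>\<tau>. of_real (\<Psi> (t - real j * h - \<tau>)) * y (\<tau> + h / 2)))"
proof -
  have "((\<lambda>\<tau>. of_real (\<Psi> (t - \<tau>)) * 0) has_integral
      (y (t + h / 2) - of_real (\<Psi> t) * y (0 + h / 2) - (\<Sum>j=1..N. of_real (ad j) *
        integral {- (real j * h)..0} (\<lambda>\<tau>. of_real (\<Psi> (t - real j * h - \<tau>)) * y (\<tau> + h / 2))))) {0..t}"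
  proof (rule variation_of_constants[OF h_pos \<Psi> _ _ _ hist t, where D="(\<lambda>s. s - h / 2) ` D"])
    show "continuous_on {0..} (\<lambda>t. y (t + h / 2))"
      by (rule continuous_on_compose2[OF cont]) (use h_pos in \<open>auto intro!: continuous_intros\<close>)
    show "countable ((\<lambda>s. s - h / 2) ` D)" using D by auto
    fix t assume t: "t > 0" "t \<notin> (\<lambda>s. s - h / 2) ` D"
    have "t + h / 2 \<notin> D" using t(2) by (metis add_diff_cancel_right' imageI)
    then have "(y has_vector_derivative (of_real a * y (t + h / 2)
        + (\<Sum>j=1..N. of_real (ad j) * y (t + h / 2 - real j * h)))) (at (t + h / 2))"
      using t(1) h_pos by (intro deriv) auto
    moreover have "((\<lambda>t. t + h / 2) has_vector_derivative 1) (at t)"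
      by (auto intro!: derivative_eq_intros simp flip: has_real_derivative_iff_has_vector_derivative)
    ultimately show "((\<lambda>t. y (t + h / 2)) has_vector_derivative (of_real a * y (t + h / 2)
        + (\<Sum>j=1..N. of_real (ad j) * y (t - real j * h + h / 2)) + 0)) (at t)"
      using vector_diff_chain_at[of "\<lambda>t. t + h / 2" 1 t y] by (simp add: o_def algebra_simps)
  qed
  then have "((\<lambda>\<tau>. 0) has_integral
      (y (t + h / 2) - of_real (\<Psi> t) * y (h / 2) - (\<Sum>j=1..N. of_real (ad j) *
        integral {- (real j * h)..0} (\<lambda>\<tau>. of_real (\<Psi> (t - real j * h - \<tau>)) * y (\<tau> + h / 2))))) {0..t}"
    by simp
  from has_integral_unique[OF this has_integral_0] show ?thesis by (simp add: algebra_simps)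
qed

lemma partial_sum_shift:
  assumes "state_transition N h a ad \<Psi>" "t \<ge> 0"
  shows "partial_sum n (t + h / 2) = of_real (\<Psi> t) * partial_sum n (h / 2) + (\<Sum>j=1..N. of_real (ad j) *
    integral {- (real j * h)..0} (\<lambda>\<tau>. of_real (\<Psi> (t - real j * h - \<tau>)) * partial_sum n (\<tau> + h / 2)))"
proof (rule homogeneous_shift[OF assms(1) partial_sum_continuous countable_empty partial_sum_dde _ assms(2)])
  show "(\<lambda>\<tau>. partial_sum n (\<tau> + h / 2)) absolutely_integrable_on {- (real N * h)..0}"
    by (intro absolutely_integrable_continuous_real continuous_on_compose2[OF partial_sum_continuous[of UNIV]]
        continuous_intros) auto
qed

lemma state_transition_shift:
  assumes \<Psi>: "state_transition N h a ad \<Psi>" and t: "t \<ge> 0"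
  shows "complex_of_real (\<Psi> (t + h / 2)) = of_real (\<Psi> t) * of_real (\<Psi> (h / 2)) + (\<Sum>j=1..N. of_real (ad j) *
    integral {- (real j * h)..0} (\<lambda>\<tau>. of_real (\<Psi> (t - real j * h - \<tau>)) * of_real (\<Psi> (\<tau> + h / 2))))"
proof -
  obtain E where E: "countable E" "\<And>t. t > 0 \<Longrightarrow> t \<notin> E \<Longrightarrow>
      (\<Psi> has_real_derivative a * \<Psi> t + (\<Sum>j=1..N. ad j * \<Psi> (t - real j * h))) (at t)"
    using state_transitionD(4)[OF \<Psi>] by blast
  show ?thesis
  proof (rule homogeneous_shift[OF \<Psi> _ E(1) _ _ t])
    show "continuous_on {0..} (\<lambda>t. complex_of_real (\<Psi> t))"
      by (intro continuous_intros state_transitionD(1)[OF \<Psi>])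
    show "((\<lambda>t. complex_of_real (\<Psi> t)) has_vector_derivative
        of_real a * of_real (\<Psi> t) + (\<Sum>j=1..N. of_real (ad j) * of_real (\<Psi> (t - real j * h)))) (at t)"
      if "t > 0" "t \<notin> E" for t
      using has_vector_derivative_of_real[OF E(2)[OF that]] by simp
    show "(\<lambda>\<tau>. complex_of_real (\<Psi> (\<tau> + h / 2))) absolutely_integrable_on {- (real N * h)..0}"
      by (rule state_transition_comp_integrable[OF \<Psi>, where T="h / 2"]) auto
  qed
qed

lemma delayed_arg_range:
  assumes "j \<in> {1..N}" "ad j \<noteq> 0"
  shows "real j * h \<le> real m * h"
  using assms above_lead[of j] h_pos by (cases "j \<le> m") (auto intro: mult_right_mono)

lemma step_exp_eq:
  assumes "state_transition N h a ad \<Psi>" "t \<le> h" "t \<noteq> 0"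
  shows "step_exp t = of_real (\<Psi> t)"
  using state_transition_first_delay[OF h_pos assms(1), of t] state_transitionD(3)[OF assms(1), of t] assms(2,3)
  by (auto simp: step_exp_def not_less simp flip: exp_of_real of_real_mult)

text \<open>
  Beyond \<open>h\<close> the bound is propagated by \<open>partial_sum_shift\<close>, in which partial sums occur only
  on the window already treated.
\<close>

lemma partial_sum_bounded:
  assumes \<Psi>: "state_transition N h a ad \<Psi>" and \<epsilon>: "0 < \<epsilon>" "\<epsilon> \<le> real m * h"
  shows "\<exists>B. eventually (\<lambda>n. \<forall>t\<in>{\<epsilon> - real m * h..T}. norm (partial_sum n t) \<le> B) sequentially"
proof -
  define \<epsilon>' where "\<epsilon>' = min \<epsilon> (h / 2)"
  have "h \<le> real m * h" using mult_right_mono[of 1 "real m" h] m_range h_pos by simp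
  then have \<epsilon>': "0 < \<epsilon>'" "\<epsilon>' \<le> real m * h" "\<epsilon>' \<le> \<epsilon>" "\<epsilon>' \<le> h / 2"
    using \<epsilon> h_pos by (auto simp: \<epsilon>'_def)
  obtain B where B: "eventually (\<lambda>n. \<forall>t\<in>{\<epsilon>' - real m * h..h}. norm (partial_sum n t) \<le> B) sequentially"
    using partial_sum_bounded_first_delay[OF \<epsilon>'(1,2)] by blast
  obtain K where K: "K \<ge> 0" "\<And>t. t \<le> T \<Longrightarrow> \<bar>\<Psi> t\<bar> \<le> K"
    using state_transition_bounded[OF \<Psi>] by blast
  define B' where "B' = K * \<bar>B\<bar> + (\<Sum>j=1..N. \<bar>ad j\<bar> * (K * \<bar>B\<bar> * (0 - (- (real j * h)))))"
  have "eventually (\<lambda>n. \<forall>t\<in>{\<epsilon> - real m * h..T}. norm (partial_sum n t) \<le> max B B') sequentially"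
    using B
  proof eventually_elim
    fix n assume n: "\<forall>t\<in>{\<epsilon>' - real m * h..h}. norm (partial_sum n t) \<le> B"
    show "\<forall>t\<in>{\<epsilon> - real m * h..T}. norm (partial_sum n t) \<le> max B B'"
    proof
      fix t assume t: "t \<in> {\<epsilon> - real m * h..T}"
      show "norm (partial_sum n t) \<le> max B B'"
      proof (cases "t \<le> h")
        case True
        then have "t \<in> {\<epsilon>' - real m * h..h}" using t \<epsilon>' by auto
        then show ?thesis using n by (simp add: le_max_iff_disj)
      next
        case False
        define s where "s = t - h / 2"
        have s: "s \<ge> 0" "s \<le> T" "t = s + h / 2" using False t h_pos by (auto simp: s_def)
        have near: "norm (partial_sum n (\<tau> + h / 2)) \<le> \<bar>B\<bar>" if "\<tau> \<in> {- (real m * h)..0}" for \<tau>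
        proof -
          have "norm (partial_sum n (\<tau> + h / 2)) \<le> B"
            by (rule n[rule_format]) (use that \<epsilon>' h_pos in auto)
          then show ?thesis by simp
        qed
        have half: "norm (partial_sum n (h / 2)) \<le> \<bar>B\<bar>" using near[of 0] mh_pos by simp
        have I: "norm (of_real (ad j) * integral {- (real j * h)..0}
              (\<lambda>\<tau>. complex_of_real (\<Psi> (s - real j * h - \<tau>)) * partial_sum n (\<tau> + h / 2)))
            \<le> \<bar>ad j\<bar> * (K * \<bar>B\<bar> * (0 - (- (real j * h))))" if j: "j \<in> {1..N}" for j
        proof (cases "ad j = 0")
          case False
          have jm: "real j * h \<le> real m * h" by (rule delayed_arg_range[OF j False])
          have "norm (integral {- (real j * h)..0}
              (\<lambda>\<tau>. complex_of_real (\<Psi> (s - real j * h - \<tau>)) * partial_sum n (\<tau> + h / 2)))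
            \<le> integral {- (real j * h)..0} (\<lambda>_. K * \<bar>B\<bar>)"
          proof (rule integral_norm_bound_integral)
            show "(\<lambda>\<tau>. complex_of_real (\<Psi> (s - real j * h - \<tau>)) * partial_sum n (\<tau> + h / 2))
                integrable_on {- (real j * h)..0}"
              by (intro set_lebesgue_integral_eq_integral(1) state_transition_product_integrable[OF \<Psi>]
                  absolutely_integrable_continuous_real continuous_on_compose2[OF partial_sum_continuous[of UNIV]]
                  continuous_intros) auto
            fix \<tau> assume \<tau>: "\<tau> \<in> {- (real j * h)..0}"
            have "\<bar>\<Psi> (s - real j * h - \<tau>)\<bar> \<le> K" using \<tau> s by (intro K(2)) auto
            moreover have "norm (partial_sum n (\<tau> + h / 2)) \<le> \<bar>B\<bar>" using \<tau> jm by (intro near) auto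
            ultimately show "norm (complex_of_real (\<Psi> (s - real j * h - \<tau>)) * partial_sum n (\<tau> + h / 2)) \<le> K * \<bar>B\<bar>"
              unfolding norm_mult norm_of_real using K(1) by (intro mult_mono) auto
          qed (rule integrable_const_ivl)
          also have "\<dots> = K * \<bar>B\<bar> * (0 - (- (real j * h)))" using h_pos by (simp add: mult.commute)
          finally show ?thesis unfolding norm_mult norm_of_real by (intro mult_left_mono) auto
        qed simp
        have "norm (partial_sum n t) \<le> norm (complex_of_real (\<Psi> s) * partial_sum n (h / 2))
            + norm (\<Sum>j=1..N. of_real (ad j) * integral {- (real j * h)..0}
              (\<lambda>\<tau>. complex_of_real (\<Psi> (s - real j * h - \<tau>)) * partial_sum n (\<tau> + h / 2)))"
          unfolding s(3) partial_sum_shift[OF \<Psi> s(1)] by (rule norm_triangle_ineq)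
        also have "\<dots> \<le> B'"
          unfolding B'_def
        proof (rule add_mono)
          show "norm (complex_of_real (\<Psi> s) * partial_sum n (h / 2)) \<le> K * \<bar>B\<bar>"
            unfolding norm_mult norm_of_real using half K(1) K(2)[OF s(2)] by (intro mult_mono) auto
        qed (rule sum_norm_le[OF I])
        finally show ?thesis by simp
      qed
    qed
  qed
  then show ?thesis by blast
qed

lemma partial_sum_tendsto:
  assumes \<Psi>: "state_transition N h a ad \<Psi>" and t: "- (real m * h) < t" "t \<noteq> 0"
  shows "(\<lambda>n. partial_sum n t) \<longlonglongrightarrow> of_real (\<Psi> t)"
proof (cases "t \<le> h")
  case True
  then show ?thesis
    using partial_sum_tendsto_first_delay[OF t(1) True t(2)] step_exp_eq[OF \<Psi> True t(2)] by simp
next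
  case False
  define s where "s = t - h / 2"
  have s: "s \<ge> 0" "t = s + h / 2" using False h_pos by (auto simp: s_def)
  have "h \<le> real m * h" using mult_right_mono[of 1 "real m" h] m_range h_pos by simp
  then have \<epsilon>: "0 < h / 2" "h / 2 \<le> real m * h" using h_pos by auto
  obtain B where B: "eventually (\<lambda>n. \<forall>t\<in>{h / 2 - real m * h..h}. norm (partial_sum n t) \<le> B) sequentially"
    using partial_sum_bounded_first_delay[OF \<epsilon>] by blast
  have first: "(\<lambda>n. partial_sum n (\<tau> + h / 2)) \<longlonglongrightarrow> of_real (\<Psi> (\<tau> + h / 2))"
    if "- (real m * h) \<le> \<tau>" "\<tau> \<le> 0" "\<tau> \<noteq> - (h / 2)" for \<tau>
    using partial_sum_tendsto_first_delay[of "\<tau> + h / 2"] step_exp_eq[OF \<Psi>, of "\<tau> + h / 2"] that h_pos by auto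
  have "(\<lambda>n. of_real (\<Psi> s) * partial_sum n (h / 2) + (\<Sum>j=1..N. of_real (ad j) *
      integral {- (real j * h)..0} (\<lambda>\<tau>. of_real (\<Psi> (s - real j * h - \<tau>)) * partial_sum n (\<tau> + h / 2))))
    \<longlonglongrightarrow> of_real (\<Psi> s) * of_real (\<Psi> (h / 2)) + (\<Sum>j=1..N. of_real (ad j) *
      integral {- (real j * h)..0} (\<lambda>\<tau>. of_real (\<Psi> (s - real j * h - \<tau>)) * of_real (\<Psi> (\<tau> + h / 2))))"
  proof (rule tendsto_add[OF tendsto_mult_left tendsto_sum])
    show "(\<lambda>n. partial_sum n (h / 2)) \<longlonglongrightarrow> of_real (\<Psi> (h / 2))"
      using first[of 0] mh_pos h_pos by simp
    fix j assume j: "j \<in> {1..N}"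
    show "(\<lambda>n. of_real (ad j) * integral {- (real j * h)..0}
          (\<lambda>\<tau>. of_real (\<Psi> (s - real j * h - \<tau>)) * partial_sum n (\<tau> + h / 2)))
        \<longlonglongrightarrow> of_real (ad j) * integral {- (real j * h)..0}
          (\<lambda>\<tau>. of_real (\<Psi> (s - real j * h - \<tau>)) * of_real (\<Psi> (\<tau> + h / 2)))"
    proof (cases "ad j = 0")
      case False
      have jm: "real j * h \<le> real m * h" by (rule delayed_arg_range[OF j False])
      show ?thesis
      proof (rule tendsto_mult_left, rule bounded_convergence_product_integral[where z="- (h / 2)"])
        show "(\<lambda>\<tau>. complex_of_real (\<Psi> (s - real j * h - \<tau>))) absolutely_integrable_on {- (real j * h)..0}"
          by (rule state_transition_comp_integrable[OF \<Psi>, where T=s]) auto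
        show "continuous_on {- (real j * h)..0} (\<lambda>\<tau>. partial_sum n (\<tau> + h / 2))" for n
          by (intro continuous_on_compose2[OF partial_sum_continuous[of UNIV]] continuous_intros) auto
        show "eventually (\<lambda>n. \<forall>\<tau>\<in>{- (real j * h)..0}. norm (partial_sum n (\<tau> + h / 2)) \<le> B) sequentially"
          using B
        proof (rule eventually_mono, intro ballI)
          fix n \<tau> assume n: "\<forall>t\<in>{h / 2 - real m * h..h}. norm (partial_sum n t) \<le> B"
            and \<tau>: "\<tau> \<in> {- (real j * h)..0}"
          have "- (real m * h) \<le> \<tau>" using \<tau> jm unfolding atLeastAtMost_iff by linarith
          then show "norm (partial_sum n (\<tau> + h / 2)) \<le> B" using \<tau> h_pos by (intro n[rule_format]) auto
        qed
        show "(\<lambda>n. partial_sum n (\<tau> + h / 2)) \<longlonglongrightarrow> of_real (\<Psi> (\<tau> + h / 2))"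
          if "\<tau> \<in> {- (real j * h)..0}" "\<tau> \<noteq> - (h / 2)" for \<tau>
        proof (rule first)
          show "- (real m * h) \<le> \<tau>" using that jm unfolding atLeastAtMost_iff by linarith
        qed (use that in auto)
      qed
    qed simp
  qed
  then show ?thesis
    unfolding s(2) partial_sum_shift[OF \<Psi> s(1)] state_transition_shift[OF \<Psi> s(1)] .
qed

section \<open>The time response\<close>

definition history_partial_sum :: "(real \<Rightarrow> real) \<Rightarrow> nat \<Rightarrow> real \<Rightarrow> complex" where
  "history_partial_sum \<phi> n t = (\<Sum>k=- int n..int n. coeff_CI N h ad \<phi> (S k) * exp (S k * of_real t))"

text \<open>
  The transform of \<open>\<phi>\<close> in \<open>coeff_CI\<close> is an integral of exponentials; together with the factor
  \<open>exp (S k * t)\<close> it becomes an integral of the \<open>k\<close>-th term of \<open>partial_sum\<close> at the argument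
  \<open>t - j h - \<tau>\<close>.
\<close>

lemma history_partial_sum_eq:
  assumes \<phi>: "continuous_on {- (real N * h)..0} \<phi>"
  shows "history_partial_sum \<phi> n t = (\<Sum>j=1..N. of_real (ad j) *
    integral {- (real j * h)..0} (\<lambda>\<tau>. of_real (\<phi> \<tau>) * partial_sum n (t - real j * h - \<tau>)))"
proof -
  define e where "e j k \<tau> = coeff_C N h ad (S k) * exp (S k * of_real (t - real j * h - \<tau>))" for j :: nat and k \<tau>
  have \<phi>_cont: "continuous_on {- (real j * h)..0} (\<lambda>\<tau>. complex_of_real (\<phi> \<tau>))" if "j \<in> {1..N}" for j
  proof -
    have "real j * h \<le> real N * h" using that h_pos by (intro mult_right_mono) auto
    then show ?thesis by (intro continuous_intros continuous_on_subset[OF \<phi>]) auto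
  qed
  have coeff: "coeff_CI N h ad \<phi> (S k) * exp (S k * of_real t)
      = (\<Sum>j=1..N. of_real (ad j) * integral {- (real j * h)..0} (\<lambda>\<tau>. of_real (\<phi> \<tau>) * e j k \<tau>))" for k
  proof -
    have "of_real (\<phi> \<tau>) * e j k \<tau> = (coeff_C N h ad (S k) * exp (- (of_nat j * S k * of_real h)) * exp (S k * of_real t))
        * (of_real (\<phi> \<tau>) * exp (- (S k * of_real \<tau>)))" for j \<tau>
      by (simp add: e_def algebra_simps flip: exp_add)
    then have "integral {- (real j * h)..0} (\<lambda>\<tau>. of_real (\<phi> \<tau>) * e j k \<tau>)
        = (coeff_C N h ad (S k) * exp (- (of_nat j * S k * of_real h)) * exp (S k * of_real t)) * hist_transform h \<phi> j (S k)" for j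
      unfolding hist_transform_def by (simp only: integral_mult_right)
    then show ?thesis
      unfolding coeff_CI_def coeff_C_def
      by (simp add: sum_divide_distrib sum_distrib_right sum_distrib_left mult_ac)
  qed
  have "history_partial_sum \<phi> n t = (\<Sum>j=1..N. of_real (ad j) *
      (\<Sum>k=- int n..int n. integral {- (real j * h)..0} (\<lambda>\<tau>. of_real (\<phi> \<tau>) * e j k \<tau>)))"
    unfolding history_partial_sum_def coeff sum_distrib_left by (rule sum.swap)
  also have "\<dots> = (\<Sum>j=1..N. of_real (ad j) *
      integral {- (real j * h)..0} (\<lambda>\<tau>. of_real (\<phi> \<tau>) * partial_sum n (t - real j * h - \<tau>)))"
  proof (rule sum.cong[OF refl])
    fix j assume j: "j \<in> {1..N}"
    have "(\<lambda>\<tau>. of_real (\<phi> \<tau>) * e j k \<tau>) integrable_on {- (real j * h)..0}" for k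
      unfolding e_def by (intro integrable_continuous_real continuous_intros \<phi>_cont j)
    then have "(\<Sum>k=- int n..int n. integral {- (real j * h)..0} (\<lambda>\<tau>. of_real (\<phi> \<tau>) * e j k \<tau>))
        = integral {- (real j * h)..0} (\<lambda>\<tau>. \<Sum>k=- int n..int n. of_real (\<phi> \<tau>) * e j k \<tau>)"
      by (intro integral_sum[symmetric]) auto
    then show "of_real (ad j) * (\<Sum>k=- int n..int n. integral {- (real j * h)..0} (\<lambda>\<tau>. of_real (\<phi> \<tau>) * e j k \<tau>))
        = of_real (ad j) * integral {- (real j * h)..0} (\<lambda>\<tau>. of_real (\<phi> \<tau>) * partial_sum n (t - real j * h - \<tau>))"
      by (simp add: partial_sum_def e_def sum_distrib_left)
  qed
  finally show ?thesis .
qed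

lemma history_partial_sum_tendsto:
  assumes \<Psi>: "state_transition N h a ad \<Psi>" and \<phi>: "continuous_on {- (real N * h)..0} \<phi>" and t: "t > 0"
  shows "(\<lambda>n. history_partial_sum \<phi> n t) \<longlonglongrightarrow> (\<Sum>j=1..N. of_real (ad j) *
    integral {- (real j * h)..0} (\<lambda>\<tau>. of_real (\<Psi> (t - real j * h - \<tau>)) * of_real (\<phi> \<tau>)))"
  unfolding history_partial_sum_eq[OF \<phi>]
proof (rule tendsto_sum)
  fix j assume j: "j \<in> {1..N}"
  define \<epsilon> where "\<epsilon> = min t (real m * h)"
  have \<epsilon>: "0 < \<epsilon>" "\<epsilon> \<le> real m * h" "\<epsilon> \<le> t" using t mh_pos by (auto simp: \<epsilon>_def)
  show "(\<lambda>n. of_real (ad j) * integral {- (real j * h)..0}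
        (\<lambda>\<tau>. of_real (\<phi> \<tau>) * partial_sum n (t - real j * h - \<tau>)))
      \<longlonglongrightarrow> of_real (ad j) * integral {- (real j * h)..0}
        (\<lambda>\<tau>. of_real (\<Psi> (t - real j * h - \<tau>)) * of_real (\<phi> \<tau>))"
  proof (cases "ad j = 0")
    case False
    have jm: "real j * h \<le> real m * h" by (rule delayed_arg_range[OF j False])
    obtain B where B: "eventually (\<lambda>n. \<forall>s\<in>{\<epsilon> - real m * h..t}. norm (partial_sum n s) \<le> B) sequentially"
      using partial_sum_bounded[OF \<Psi> \<epsilon>(1,2)] by blast
    have range: "\<epsilon> - real m * h \<le> t - real j * h - \<tau>" "t - real j * h - \<tau> \<le> t" if "\<tau> \<in> {- (real j * h)..0}" for \<tau>
      using that jm \<epsilon>(3) unfolding atLeastAtMost_iff by linarith+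
    have "(\<lambda>n. integral {- (real j * h)..0} (\<lambda>\<tau>. of_real (\<phi> \<tau>) * partial_sum n (t - real j * h - \<tau>)))
      \<longlonglongrightarrow> integral {- (real j * h)..0} (\<lambda>\<tau>. of_real (\<phi> \<tau>) * of_real (\<Psi> (t - real j * h - \<tau>)))"
    proof (rule bounded_convergence_product_integral[where z="t - real j * h"])
      have "real j * h \<le> real N * h" using j h_pos by (intro mult_right_mono) auto
      then show "(\<lambda>\<tau>. complex_of_real (\<phi> \<tau>)) absolutely_integrable_on {- (real j * h)..0}"
        by (intro absolutely_integrable_continuous_real continuous_intros continuous_on_subset[OF \<phi>]) auto
      show "continuous_on {- (real j * h)..0} (\<lambda>\<tau>. partial_sum n (t - real j * h - \<tau>))" for n
        by (intro continuous_on_compose2[OF partial_sum_continuous[of UNIV]] continuous_intros) auto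
      show "eventually (\<lambda>n. \<forall>\<tau>\<in>{- (real j * h)..0}. norm (partial_sum n (t - real j * h - \<tau>)) \<le> B) sequentially"
        using B by (rule eventually_mono) (use range in auto)
      show "(\<lambda>n. partial_sum n (t - real j * h - \<tau>)) \<longlonglongrightarrow> of_real (\<Psi> (t - real j * h - \<tau>))"
        if "\<tau> \<in> {- (real j * h)..0}" "\<tau> \<noteq> t - real j * h" for \<tau>
        using range(1)[OF that(1)] \<epsilon>(1) that(2) by (intro partial_sum_tendsto[OF \<Psi>]) auto
    qed
    then show ?thesis by (intro tendsto_mult_left) (simp add: mult.commute)
  qed simp
qed

text \<open>
  Integrability of the forcing term is part of the result: it is what remains of the
  derivative of \<open>\<Psi> (t - \<tau>) * x \<tau>\<close>, which is gauge integrable, after integrable terms have been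
  removed.
\<close>

lemma time_response_formula:
  assumes \<Psi>: "state_transition N h a ad \<Psi>" and \<phi>: "continuous_on {- (real N * h)..0} \<phi>"
    and x: "time_response N h a ad b u x0 \<phi> x" and t: "t > 0"
  shows "((\<lambda>\<tau>. complex_of_real (\<Psi> (t - \<tau>)) * of_real (b * u \<tau>)) has_integral
    (of_real (x t) - of_real (\<Psi> t) * of_real x0 - (\<Sum>j=1..N. of_real (ad j) *
    integral {- (real j * h)..0} (\<lambda>\<tau>. of_real (\<Psi> (t - real j * h - \<tau>)) * of_real (\<phi> \<tau>))))) {0..t}"
proof -
  have x0: "x 0 = x0" and hist: "\<And>\<tau>. - (real N * h) \<le> \<tau> \<Longrightarrow> \<tau> < 0 \<Longrightarrow> x \<tau> = \<phi> \<tau>"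
    and cont: "continuous_on {0..} x"
    using x by (auto simp: time_response_def satisfies_dde_def)
  obtain D where D: "countable D" "\<And>t. t > 0 \<Longrightarrow> t \<notin> D \<Longrightarrow> (x has_real_derivative
      a * x t + (\<Sum>j=1..N. ad j * x (t - real j * h)) + b * u t) (at t)"
    using x by (auto simp: time_response_def satisfies_dde_def)
  have "((\<lambda>\<tau>. of_real (\<Psi> (t - \<tau>)) * of_real (b * u \<tau>)) has_integral
      (of_real (x t) - of_real (\<Psi> t) * of_real (x 0) - (\<Sum>j=1..N. of_real (ad j) *
      integral {- (real j * h)..0} (\<lambda>\<tau>. of_real (\<Psi> (t - real j * h - \<tau>)) * complex_of_real (x \<tau>))))) {0..t}"
  proof (rule variation_of_constants[OF h_pos \<Psi> _ D(1)])
    show "continuous_on {0..} (\<lambda>t. complex_of_real (x t))" by (intro continuous_intros cont)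
    show "((\<lambda>t. complex_of_real (x t)) has_vector_derivative of_real a * of_real (x t)
        + (\<Sum>j=1..N. of_real (ad j) * of_real (x (t - real j * h))) + of_real (b * u t)) (at t)"
      if "t > 0" "t \<notin> D" for t
      using has_vector_derivative_of_real[OF D(2)[OF that]] by simp
    have "(\<lambda>\<tau>. complex_of_real (\<phi> \<tau>)) absolutely_integrable_on {- (real N * h)..0}"
      by (intro absolutely_integrable_continuous_real continuous_intros \<phi>)
    then show "(\<lambda>\<tau>. complex_of_real (x \<tau>)) absolutely_integrable_on {- (real N * h)..0}"
      by (rule absolutely_integrable_spike[where S="{0}"]) (auto simp: hist)
  qed (use t in simp)
  moreover have "integral {- (real j * h)..0} (\<lambda>\<tau>. of_real (\<Psi> (t - real j * h - \<tau>)) * complex_of_real (x \<tau>))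
      = integral {- (real j * h)..0} (\<lambda>\<tau>. of_real (\<Psi> (t - real j * h - \<tau>)) * complex_of_real (\<phi> \<tau>))"
    if j: "j \<in> {1..N}" for j
  proof (rule integral_spike[of "{0}"])
    have jN: "real j * h \<le> real N * h" using j h_pos by (intro mult_right_mono) auto
    fix \<tau> assume \<tau>: "\<tau> \<in> {- (real j * h)..0} - {0}"
    then have "- (real N * h) \<le> \<tau>" using jN unfolding Diff_iff atLeastAtMost_iff by linarith
    then have "x \<tau> = \<phi> \<tau>" using \<tau> by (intro hist) auto
    then show "of_real (\<Psi> (t - real j * h - \<tau>)) * complex_of_real (\<phi> \<tau>)
        = of_real (\<Psi> (t - real j * h - \<tau>)) * complex_of_real (x \<tau>)" by simp
  qed simp
  ultimately show ?thesis by (simp add: x0)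
qed

end

theorem mainTheorem2:
  fixes N :: nat and h a b x0 :: real and ad :: "nat \<Rightarrow> real"
    and \<phi> u \<Psi> x :: "real \<Rightarrow> real" and S :: "int \<Rightarrow> complex"
  assumes "h > 0"
    and "\<exists>j\<in>{1..N}. ad j \<noteq> 0"
    and "continuous_on {- (real N * h)..0} \<phi>"
    and "u \<in> borel_measurable (lebesgue_on {0..})"
    and "exponential_order u"
    and "root_numbering N h a ad S"
    and "\<forall>k. coeff_denom N h ad (S k) \<noteq> 0"
    and "state_transition N h a ad \<Psi>"
    and "time_response N h a ad b u x0 \<phi> x"
  shows "(\<forall>t>0.
            bilateral_summable (\<lambda>k. coeff_C N h ad (S k) * exp (S k * of_real t)) \<and>
            of_real (\<Psi> t) = transition_series N h ad S t)
       \<and> (transition_series N h ad S \<longlongrightarrow> of_real (\<Psi> 0)) (at_right 0)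
       \<and> (\<forall>t>0.
            bilateral_summable (\<lambda>k. coeff_CI N h ad \<phi> (S k) * exp (S k * of_real t)) \<and>
            (\<lambda>\<tau>. transition_series N h ad S (t - \<tau>) * of_real b * of_real (u \<tau>))
              integrable_on {0..t} \<and>
            of_real (x t) = response_series N h ad b u x0 \<phi> S t)
       \<and> (response_series N h ad b u x0 \<phi> S \<longlongrightarrow> of_real (x 0)) (at_right 0)"
proof -
  define m where "m = Max {j\<in>{1..N}. ad j \<noteq> 0}"
  have m: "m \<in> {j\<in>{1..N}. ad j \<noteq> 0}"
    unfolding m_def using assms(2) by (intro Max_in) auto
  have m_max: "j \<le> m" if "j \<in> {1..N}" "ad j \<noteq> 0" for j
    unfolding m_def using that by (intro Max_ge) auto
  interpret numbered_delay_system N h a ad m S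
  proof
    show "ad j = 0" if "m < j" "j \<le> N" for j
      using m_max[of j] that by (cases "ad j = 0") auto
  qed (use assms m in auto)
  note \<Psi> = assms(8) and x = assms(9)
  have \<Psi>_lim: "(\<lambda>n. partial_sum n t) \<longlonglongrightarrow> of_real (\<Psi> t)" if "t > 0" for t
    using that mh_pos by (intro partial_sum_tendsto[OF \<Psi>]) auto
  have series: "transition_series N h ad S t = of_real (\<Psi> t)" if "t > 0" for t
    using limI[OF \<Psi>_lim[OF that]]
    by (simp add: transition_series_def bilateral_sum_def partial_sum_def)
  have CI_lim: "(\<lambda>n. history_partial_sum \<phi> n t) \<longlonglongrightarrow> (\<Sum>j=1..N. of_real (ad j) *
      integral {- (real j * h)..0} (\<lambda>\<tau>. of_real (\<Psi> (t - real j * h - \<tau>)) * of_real (\<phi> \<tau>)))"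
    if "t > 0" for t
    by (rule history_partial_sum_tendsto[OF \<Psi> assms(3) that])
  have forcing: "((\<lambda>\<tau>. transition_series N h ad S (t - \<tau>) * of_real b * of_real (u \<tau>)) has_integral
      (of_real (x t) - of_real (\<Psi> t) * of_real x0 - (\<Sum>j=1..N. of_real (ad j) *
      integral {- (real j * h)..0} (\<lambda>\<tau>. of_real (\<Psi> (t - real j * h - \<tau>)) * of_real (\<phi> \<tau>))))) {0..t}"
    if "t > 0" for t
    by (rule has_integral_spike_finite[OF _ _ time_response_formula[OF \<Psi> assms(3) x that], of "{t}"])
      (auto simp: series)
  have response: "response_series N h ad b u x0 \<phi> S t = of_real (x t)" if t: "t > 0" for t
  proof -
    have "bilateral_sum (\<lambda>k. coeff_C N h ad (S k) * exp (S k * of_real t) * of_real x0) = of_real (\<Psi> t) * of_real x0"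
      using limI[OF tendsto_mult_right[OF \<Psi>_lim[OF t], of "of_real x0"]]
      by (simp add: bilateral_sum_def partial_sum_def sum_distrib_right)
    moreover have "bilateral_sum (\<lambda>k. coeff_CI N h ad \<phi> (S k) * exp (S k * of_real t)) = (\<Sum>j=1..N. of_real (ad j) *
      integral {- (real j * h)..0} (\<lambda>\<tau>. of_real (\<Psi> (t - real j * h - \<tau>)) * of_real (\<phi> \<tau>)))"
      using limI[OF CI_lim[OF t]] by (simp add: bilateral_sum_def history_partial_sum_def)
    ultimately show ?thesis
      unfolding response_series_def integral_unique[OF forcing[OF t]] by simp
  qed
  have right_limit: "((\<lambda>t. complex_of_real (f t)) \<longlongrightarrow> of_real (f 0)) (at_right 0)"
    if "continuous_on {0..} f" for f :: "real \<Rightarrow> real"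
  proof -
    have "(f \<longlongrightarrow> f 0) (at 0 within {0..})" using that by (simp add: continuous_on_def)
    then show ?thesis by (intro tendsto_of_real) (rule tendsto_within_subset, auto)
  qed
  have "(transition_series N h ad S \<longlongrightarrow> of_real (\<Psi> 0)) (at_right 0)"
    by (rule Lim_transform_eventually[OF right_limit[OF state_transitionD(1)[OF \<Psi>]]])
      (auto simp: eventually_at_right_field series intro!: exI[of _ 1])
  moreover have "continuous_on {0..} x"
    using x by (simp add: time_response_def satisfies_dde_def)
  then have "(response_series N h ad b u x0 \<phi> S \<longlongrightarrow> of_real (x 0)) (at_right 0)"
    by (intro Lim_transform_eventually[OF right_limit])
      (auto simp: eventually_at_right_field response intro!: exI[of _ 1])
  moreover have "bilateral_summable (\<lambda>k. coeff_C N h ad (S k) * exp (S k * of_real t))" if "t > 0" for t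
    using \<Psi>_lim[OF that] by (auto simp: bilateral_summable_def partial_sum_def convergent_def)
  moreover have "bilateral_summable (\<lambda>k. coeff_CI N h ad \<phi> (S k) * exp (S k * of_real t))" if "t > 0" for t
    using CI_lim[OF that] by (auto simp: bilateral_summable_def history_partial_sum_def convergent_def)
  moreover have "(\<lambda>\<tau>. transition_series N h ad S (t - \<tau>) * of_real b * of_real (u \<tau>)) integrable_on {0..t}"
    if "t > 0" for t
    using forcing[OF that] by blast
  ultimately show ?thesis using series response by simp
qed

end
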